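(* Let $\varphi$ be an extreme point of the set $\mathcal S_{\mathbb P_{\mathbb N}}(\mathrm{CAR}(\mathbb N))$ of symmetric states. Then for each $A\in\mathrm{CAR}(\mathbb N)$, in the weak operator topology, $$\mathrm{w}\text{-}\lim_{n}U_\varphi(g_n)\pi_\varphi(A)U_\varphi(g_n)^{-1}=\varphi(A)1=\Phi_\varphi(\pi_\varphi(A)).$$
   Context: $\mathrm{CAR}(\mathbb N)$ is the unital $C^*$-algebra generated by $\{a_j,a_j^\dagger : j\in\mathbb N\}$, $\mathbb N=\{1,2,\dots\}$, with $(a_j)^*=a_j^\dagger$, $\{a_j^\dagger,a_k\}=\delta_{jk}1$, $\{a_j,a_k\}=\{a_j^\dagger,a_k^\dagger\}=0$, where $\{a,b\}=ab+ba$. $\mathbb P_{\mathbb N}$ is the group of permutations of $\mathbb N$ moving only finitely many elements, acting on $\mathrm{CAR}(\mathbb N)$ by the automorphisms $\alpha_g$ with $\alpha_g(a_j)=a_{gj}$; $\mathcal S_{\mathbb P_{\mathbb N}}(\mathrm{CAR}(\mathbb N))$ is the convex set of states invariant under all $\alpha_g$ (symmetric states). For $n\in\mathbb N$ let $g_n\in\mathbb P_{\mathbb N}$ be $$g_n(k)=\begin{cases}2^{n-1}+k & 1\le k\le 2^{n-1},\\ k-2^{n-1} & 2^{n-1}<k\le 2^n,\\ k & 2^n<k.\end{cases}$$ For a symmetric state $\varphi$, $(\pi_\varphi,\mathcal H_\varphi,\Omega_\varphi)$ is its GNS triple and $U_\varphi$ the unitary representation of $\mathbb P_{\mathbb N}$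 with $\pi_\varphi(\alpha_g(A))=U_\varphi(g)\pi_\varphi(A)U_\varphi(g)^{-1}$, $U_\varphi(g)\Omega_\varphi=\Omega_\varphi$. Let $\mathfrak Z_\varphi=\pi_\varphi(\mathrm{CAR}(\mathbb N))''\cap\pi_\varphi(\mathrm{CAR}(\mathbb N))'$ and $\mathfrak B_{\mathbb P_{\mathbb N}}(\varphi)=\{Z\in\mathfrak Z_\varphi : U_\varphi(g)ZU_\varphi(g)^{-1}=Z,\ g\in\mathbb P_{\mathbb N}\}$. $\Phi_\varphi:\pi_\varphi(\mathrm{CAR}(\mathbb N))''\to\mathfrak B_{\mathbb P_{\mathbb N}}(\varphi)$ is the conditional expectation onto $\mathfrak B_{\mathbb P_{\mathbb N}}(\varphi)$ leaving the vector state $\langle\,\cdot\,\Omega_\varphi,\Omega_\varphi\rangle$ invariant (it exists, by a theorem of Størmer, because $\mathbb P_{\mathbb N}$ acts as a large group of automorphisms, and is unique since $\Omega_\varphi$ is separating for $\mathfrak B_{\mathbb P_{\mathbb N}}(\varphi)$). *)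

theory Defs
  imports "HOL-Analysis.Analysis" "HOL-Combinatorics.Permutations"
begin

section \<open>C*-algebras and complex Hilbert spaces\<close>

class complex_normed_vector = real_normed_vector +
  fixes scaleC :: "complex \<Rightarrow> 'a \<Rightarrow> 'a" (infixr \<open>*\<^sub>C\<close> 75)
  assumes scaleC_add_right: "c *\<^sub>C (x + y) = c *\<^sub>C x + c *\<^sub>C y"
    and scaleC_add_left: "(c + d) *\<^sub>C x = c *\<^sub>C x + d *\<^sub>C x"
    and scaleC_scaleC: "c *\<^sub>C (d *\<^sub>C x) = (c * d) *\<^sub>C x"
    and scaleC_of_real: "complex_of_real r *\<^sub>C x = r *\<^sub>R x"
    and norm_scaleC: "norm (c *\<^sub>C x) = cmod c * norm x"

text \<open>Unital C*-algebras. The class \<open>real_normed_algebra_1\<close> supplies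
  submultiplicativity of the norm and \<open>norm 1 = 1\<close>, so the zero algebra is excluded.\<close>

class cstar_algebra = complex_normed_vector + real_normed_algebra_1 + complete_space +
  fixes adj :: "'a \<Rightarrow> 'a"
  assumes mult_scaleC_left: "(c *\<^sub>C x) * y = c *\<^sub>C (x * y)"
    and mult_scaleC_right: "x * (c *\<^sub>C y) = c *\<^sub>C (x * y)"
    and adj_add: "adj (x + y) = adj x + adj y"
    and adj_scaleC: "adj (c *\<^sub>C x) = cnj c *\<^sub>C adj x"
    and adj_mult: "adj (x * y) = adj y * adj x"
    and adj_adj: "adj (adj x) = x"
    and cstar_identity: "norm (adj x * x) = (norm x)\<^sup>2"

text \<open>The inner product is linear in its first argument.\<close>

class complex_hilbert_space = complex_normed_vector + complete_space +
  fixes cinner :: "'a \<Rightarrow> 'a \<Rightarrow> complex"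
  assumes cinner_add_left: "cinner (x + y) z = cinner x z + cinner y z"
    and cinner_scaleC_left: "cinner (c *\<^sub>C x) y = c * cinner x y"
    and cinner_commute: "cinner x y = cnj (cinner y x)"
    and cinner_self: "cinner x x = complex_of_real ((norm x)\<^sup>2)"


section \<open>The CAR algebra over the positive integers\<close>

definition cstar_subalgebra :: "'a::cstar_algebra set \<Rightarrow> bool" where
  "cstar_subalgebra B \<longleftrightarrow> closed B \<and> 1 \<in> B \<and>
     (\<forall>x\<in>B. \<forall>y\<in>B. x + y \<in> B \<and> x * y \<in> B) \<and>
     (\<forall>c. \<forall>x\<in>B. c *\<^sub>C x \<in> B) \<and> (\<forall>x\<in>B. adj x \<in> B)"

definition cstar_generated :: "'a::cstar_algebra set \<Rightarrow> 'a set" where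
  "cstar_generated S = \<Inter>{B. cstar_subalgebra B \<and> S \<subseteq> B}"

definition anticommutator :: "'a::ring \<Rightarrow> 'a \<Rightarrow> 'a" where
  "anticommutator x y = x * y + y * x"

text \<open>The type \<open>'a\<close> is CAR(N), with annihilators \<open>a 1, a 2, \<dots>\<close>.
  The value \<open>a 0\<close> is not part of the data and is never used. Any two unital C*-algebras
  generated by elements satisfying these relations are isomorphic by an isomorphism
  matching the generators, so this determines the algebra.\<close>

definition car_algebra :: "(nat \<Rightarrow> 'a::cstar_algebra) \<Rightarrow> bool" where
  "car_algebra a \<longleftrightarrow>
     (\<forall>j\<in>{1..}. \<forall>k\<in>{1..}.
        anticommutator (adj (a j)) (a k) = (if j = k then 1 else 0) \<and>
        anticommutator (a j) (a k) = 0 \<and>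
        anticommutator (adj (a j)) (adj (a k)) = 0) \<and>
     cstar_generated (a ` {1..} \<union> (\<lambda>j. adj (a j)) ` {1..}) = UNIV"

definition finite_perms :: "(nat \<Rightarrow> nat) set" where
  "finite_perms = {g. g permutes {1..} \<and> finite {k. g k \<noteq> k}}"

text \<open>The norm is part of the structure preserved; for *-automorphisms of a C*-algebra
  this is automatic.\<close>

definition cstar_automorphism :: "('a::cstar_algebra \<Rightarrow> 'a) \<Rightarrow> bool" where
  "cstar_automorphism f \<longleftrightarrow> bij f \<and>
     (\<forall>x y. f (x + y) = f x + f y) \<and> (\<forall>c x. f (c *\<^sub>C x) = c *\<^sub>C f x) \<and>
     (\<forall>x y. f (x * y) = f x * f y) \<and> (\<forall>x. f (adj x) = adj (f x)) \<and>
     (\<forall>x. norm (f x) = norm x)"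

definition car_action :: "(nat \<Rightarrow> 'a::cstar_algebra) \<Rightarrow> (nat \<Rightarrow> nat) \<Rightarrow> 'a \<Rightarrow> 'a" where
  "car_action a g = (THE f. cstar_automorphism f \<and> (\<forall>j\<in>{1..}. f (a j) = a (g j)))"

text \<open>The permutation exchanging the blocks \<open>{1..2^(n-1)}\<close> and \<open>{2^(n-1)+1..2^n}\<close>,
  for \<open>n \<ge> 1\<close>.\<close>

definition block_swap :: "nat \<Rightarrow> nat \<Rightarrow> nat" where
  "block_swap n k =
     (if 1 \<le> k \<and> k \<le> 2 ^ (n - 1) then 2 ^ (n - 1) + k
      else if 2 ^ (n - 1) < k \<and> k \<le> 2 ^ n then k - 2 ^ (n - 1)
      else k)"


section \<open>Symmetric states\<close>

text \<open>States live in the dual space, so that the convexity notions of the library apply.\<close>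

definition states :: "('a::cstar_algebra \<Rightarrow>\<^sub>L complex) set" where
  "states = {\<phi> :: 'a \<Rightarrow>\<^sub>L complex. (\<forall>c x. \<phi> (c *\<^sub>C x) = c * \<phi> x) \<and>
                (\<forall>x. \<phi> (adj x * x) \<in> \<real>\<^sub>\<ge>\<^sub>0) \<and> \<phi> 1 = 1}"

definition symmetric_states ::
    "(nat \<Rightarrow> 'a::cstar_algebra) \<Rightarrow> ('a \<Rightarrow>\<^sub>L complex) set" where
  "symmetric_states a =
     {\<phi> \<in> states. \<forall>g\<in>finite_perms. \<forall>x. \<phi> (car_action a g x) = \<phi> x}"


section \<open>Operators on a Hilbert space\<close>

definition bounded_ops :: "('h::complex_hilbert_space \<Rightarrow> 'h) set" where
  "bounded_ops = {T. bounded_linear T \<and> (\<forall>c x. T (c *\<^sub>C x) = c *\<^sub>C T x)}"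

definition unitary_op :: "('h::complex_hilbert_space \<Rightarrow> 'h) \<Rightarrow> bool" where
  "unitary_op T \<longleftrightarrow> T \<in> bounded_ops \<and> surj T \<and> (\<forall>x y. cinner (T x) (T y) = cinner x y)"

definition positive_op :: "('h::complex_hilbert_space \<Rightarrow> 'h) \<Rightarrow> bool" where
  "positive_op T \<longleftrightarrow> T \<in> bounded_ops \<and> (\<forall>x. cinner (T x) x \<in> \<real>\<^sub>\<ge>\<^sub>0)"

text \<open>The coarsest topology on the bounded operators making all matrix coefficients
  \<open>T \<mapsto> \<langle>T x, y\<rangle>\<close> continuous.\<close>

definition weak_operator_topology :: "('h::complex_hilbert_space \<Rightarrow> 'h) topology" where
  "weak_operator_topology =
     topology_generated_by {{T \<in> bounded_ops. cinner (T x) y \<in> V} | x y V. open V}"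

definition commutant ::
    "('h::complex_hilbert_space \<Rightarrow> 'h) set \<Rightarrow> ('h \<Rightarrow> 'h) set" where
  "commutant S = {T \<in> bounded_ops. \<forall>X\<in>S. T \<circ> X = X \<circ> T}"


section \<open>GNS representation and the conditional expectation\<close>

definition star_representation ::
    "('a::cstar_algebra \<Rightarrow> 'h::complex_hilbert_space \<Rightarrow> 'h) \<Rightarrow> bool" where
  "star_representation \<pi> \<longleftrightarrow> (\<forall>A. \<pi> A \<in> bounded_ops) \<and> \<pi> 1 = id \<and>
     (\<forall>A B x. \<pi> (A + B) x = \<pi> A x + \<pi> B x) \<and>
     (\<forall>c A x. \<pi> (c *\<^sub>C A) x = c *\<^sub>C \<pi> A x) \<and>
     (\<forall>A B. \<pi> (A * B) = \<pi> A \<circ> \<pi> B) \<and>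
     (\<forall>A x y. cinner (\<pi> A x) y = cinner x (\<pi> (adj A) y))"

definition gns_triple ::
    "('a::cstar_algebra \<Rightarrow>\<^sub>L complex) \<Rightarrow>
     ('a \<Rightarrow> 'h::complex_hilbert_space \<Rightarrow> 'h) \<Rightarrow> 'h \<Rightarrow> bool" where
  "gns_triple \<phi> \<pi> \<Omega> \<longleftrightarrow> star_representation \<pi> \<and>
     closure (range (\<lambda>A. \<pi> A \<Omega>)) = UNIV \<and> (\<forall>A. cinner (\<pi> A \<Omega>) \<Omega> = \<phi> A)"

text \<open>\<open>U\<close> is the unitary representation of the finite permutations implementing the
  action and fixing \<open>\<Omega>\<close>; by cyclicity of \<open>\<Omega>\<close> there is exactly one (on \<open>finite_perms\<close>).\<close>

definition gns_implementation ::
    "(nat \<Rightarrow> 'a::cstar_algebra) \<Rightarrow> ('a \<Rightarrow> 'h::complex_hilbert_space \<Rightarrow> 'h) \<Rightarrow> 'h \<Rightarrow>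
     ((nat \<Rightarrow> nat) \<Rightarrow> 'h \<Rightarrow> 'h) \<Rightarrow> bool" where
  "gns_implementation a \<pi> \<Omega> U \<longleftrightarrow>
     (\<forall>g\<in>finite_perms. unitary_op (U g)) \<and>
     (\<forall>g\<in>finite_perms. \<forall>h\<in>finite_perms. U (g \<circ> h) = U g \<circ> U h) \<and>
     (\<forall>g\<in>finite_perms. \<forall>A. \<pi> (car_action a g A) = U g \<circ> \<pi> A \<circ> inv (U g)) \<and>
     (\<forall>g\<in>finite_perms. U g \<Omega> = \<Omega>)"

definition gns_vn_algebra ::
    "('a::cstar_algebra \<Rightarrow> 'h::complex_hilbert_space \<Rightarrow> 'h) \<Rightarrow> ('h \<Rightarrow> 'h) set" where
  "gns_vn_algebra \<pi> = commutant (commutant (range \<pi>))"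

definition gns_center ::
    "('a::cstar_algebra \<Rightarrow> 'h::complex_hilbert_space \<Rightarrow> 'h) \<Rightarrow> ('h \<Rightarrow> 'h) set" where
  "gns_center \<pi> = gns_vn_algebra \<pi> \<inter> commutant (range \<pi>)"

definition invariant_center ::
    "('a::cstar_algebra \<Rightarrow> 'h::complex_hilbert_space \<Rightarrow> 'h) \<Rightarrow>
     ((nat \<Rightarrow> nat) \<Rightarrow> 'h \<Rightarrow> 'h) \<Rightarrow> ('h \<Rightarrow> 'h) set" where
  "invariant_center \<pi> U =
     {Z \<in> gns_center \<pi>. \<forall>g\<in>finite_perms. U g \<circ> Z \<circ> inv (U g) = Z}"

text \<open>A conditional expectation of the operator algebra \<open>M\<close> onto its subalgebra \<open>N\<close>:
  a positive linear \<open>N\<close>-bimodule projection. Membership in \<open>M \<rightarrow>\<^sub>E N\<close> fixes its value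
  to \<open>undefined\<close> off \<open>M\<close>, so that uniqueness on \<open>M\<close> is uniqueness as a HOL function.\<close>

definition conditional_expectation ::
    "('h::complex_hilbert_space \<Rightarrow> 'h) set \<Rightarrow> ('h \<Rightarrow> 'h) set \<Rightarrow>
     (('h \<Rightarrow> 'h) \<Rightarrow> ('h \<Rightarrow> 'h)) \<Rightarrow> bool" where
  "conditional_expectation M N E \<longleftrightarrow> E \<in> M \<rightarrow>\<^sub>E N \<and>
     (\<forall>X\<in>M. \<forall>Y\<in>M. E (\<lambda>x. X x + Y x) = (\<lambda>x. E X x + E Y x)) \<and>
     (\<forall>c. \<forall>X\<in>M. E (\<lambda>x. c *\<^sub>C X x) = (\<lambda>x. c *\<^sub>C E X x)) \<and>
     (\<forall>X\<in>M. positive_op X \<longrightarrow> positive_op (E X)) \<and>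
     (\<forall>Z\<in>N. E Z = Z) \<and>
     (\<forall>Z\<in>N. \<forall>X\<in>M. \<forall>W\<in>N. E (Z \<circ> X \<circ> W) = Z \<circ> E X \<circ> W)"

definition gns_expectation ::
    "('a::cstar_algebra \<Rightarrow> 'h::complex_hilbert_space \<Rightarrow> 'h) \<Rightarrow> 'h \<Rightarrow>
     ((nat \<Rightarrow> nat) \<Rightarrow> 'h \<Rightarrow> 'h) \<Rightarrow> ('h \<Rightarrow> 'h) \<Rightarrow> ('h \<Rightarrow> 'h)" where
  "gns_expectation \<pi> \<Omega> U =
     (THE E. conditional_expectation (gns_vn_algebra \<pi>) (invariant_center \<pi> U) E \<and>
             (\<forall>X\<in>gns_vn_algebra \<pi>. cinner (E X \<Omega>) \<Omega> = cinner (X \<Omega>) \<Omega>))"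

end

theory Submission
  imports Defs
begin

text \<open>Write \<open>\<alpha>\<^sub>n\<close> for the action of \<open>block_swap n\<close>. By symmetry the numbers
  \<open>\<phi> (X \<alpha>\<^sub>n(A) Y)\<close> are eventually constant for monomials \<open>X\<close>, \<open>A\<close>, \<open>Y\<close> in the generators.
  For odd \<open>A\<close> the shifted copies of \<open>A\<close> anticommute, so their averages tend to zero.
  For even \<open>A\<close> they asymptotically commute with everything, and \<open>X \<mapsto> lim \<phi> (X \<alpha>\<^sub>n(A))\<close> is a
  symmetric functional dominated by \<open>\<phi>\<close>; extremality makes it a multiple of \<open>\<phi>\<close>. The same
  domination argument shows that the invariant center is trivial, which determines the
  conditional expectation.\<close>

section \<open>Monomials in the generators\<close>

text \<open>The obstacle is the grading: elements at disjoint sets of indices commute only up to a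
  sign, so the system is not asymptotically abelian. Eventual constancy has a concrete source: for
  large n the swap translates a fixed word by a power of two, and two such translates are exchanged
  by a finite permutation that fixes the other words. Domination means
  \<open>cmod (f (adj x * x)) \<le> K * Re (\<phi> (adj x * x))\<close>. For a symmetric f that is
  real on positive elements and satisfies \<open>f 1 = 0\<close>, adding or subtracting a small
  multiple of f to \<phi> gives two symmetric states with midpoint \<phi>, which extremality forces
  to coincide. For the limit functional, K is the operator norm of the represented element; for an
  element Z of the invariant center, it is the operator norm of Z. Limits are computed on monomials
  and extended by density, which requires bounds uniform in n; these come from the isometry of the
  automorphisms and the unitarity of U.\<close>

lemma scaleC_zero_right [simp]: "c *\<^sub>C (0::'a::complex_normed_vector) = 0"
  using scaleC_add_right[of c 0 "0::'a"] by simp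

lemma scaleC_zero_left [simp]: "0 *\<^sub>C (x::'a::complex_normed_vector) = 0"
  using scaleC_add_left[of 0 0 x] by simp

lemma scaleC_one [simp]: "1 *\<^sub>C (x::'a::complex_normed_vector) = x"
  using scaleC_of_real[of 1 x] by simp

lemma scaleC_minus_right: "c *\<^sub>C (- x) = - (c *\<^sub>C (x::'a::complex_normed_vector))"
  using scaleC_add_right[of c x "-x"] by (simp add: eq_neg_iff_add_eq_0 add.commute)

lemma scaleC_minus_left: "(- c) *\<^sub>C x = - (c *\<^sub>C (x::'a::complex_normed_vector))"
  using scaleC_add_left[of c "-c" x] by (simp add: eq_neg_iff_add_eq_0 add.commute)

lemma scaleC_diff_right: "c *\<^sub>C (x - y) = c *\<^sub>C x - c *\<^sub>C (y::'a::complex_normed_vector)"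
  using scaleC_add_right[of c x "-y"] by (simp add: scaleC_minus_right)

lemma bounded_linear_scaleC_right:
  "bounded_linear (\<lambda>x. c *\<^sub>C (x::'a::complex_normed_vector))"
proof (rule bounded_linear_intro[where K="cmod c"])
  show "c *\<^sub>C (r *\<^sub>R x) = r *\<^sub>R (c *\<^sub>C x)" for r and x :: 'a
    by (metis scaleC_of_real scaleC_scaleC mult.commute)
qed (simp_all add: scaleC_add_right norm_scaleC)

lemma adj_zero [simp]: "adj (0::'a::cstar_algebra) = 0"
  using adj_add[of "0::'a" 0] by simp

lemma adj_minus: "adj (- x) = - adj (x::'a::cstar_algebra)"
  using adj_add[of x "-x"] by (simp add: eq_neg_iff_add_eq_0 add.commute)

lemma adj_diff: "adj (x - y) = adj x - adj (y::'a::cstar_algebra)"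
  using adj_add[of x "-y"] by (simp add: adj_minus)

lemma adj_one [simp]: "adj (1::'a::cstar_algebra) = 1"
  by (metis adj_adj adj_mult mult.right_neutral mult_1)

text \<open>The C*-identity and submultiplicativity give \<open>norm y \<le> norm (adj y)\<close>
  after cancelling \<open>norm y\<close>; applying this to the adjoint gives equality.\<close>

lemma norm_adj [simp]: "norm (adj x) = norm (x::'a::cstar_algebra)"
proof -
  have le: "norm y \<le> norm (adj y)" for y :: 'a
  proof (cases "norm y = 0")
    case False
    have "norm y * norm y \<le> norm (adj y) * norm y"
      using cstar_identity[of y] norm_mult_ineq[of "adj y" y] by (simp add: power2_eq_square)
    then show ?thesis using False by (simp add: mult_le_cancel_right)
  qed simp
  show ?thesis using le[of x] le[of "adj x"] by (simp add: adj_adj)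
qed

lemma bounded_linear_adj: "bounded_linear (adj :: 'a::cstar_algebra \<Rightarrow> 'a)"
proof (rule bounded_linear_intro[where K=1])
  show "adj (r *\<^sub>R x) = r *\<^sub>R adj x" for r and x :: 'a
    by (metis adj_scaleC complex_cnj_complex_of_real scaleC_of_real)
qed (simp_all add: adj_add)

text \<open>The Lipschitz constant is common to all indices, so a single approximating point of the
  dense set serves the whole family. With a family constant in i this also shows that a Lipschitz
  map vanishing on a dense set is zero.\<close>

lemma tendsto_zero_of_dense:
  fixes d :: "'i \<Rightarrow> 'x::real_normed_vector \<Rightarrow> 'y::real_normed_vector"
  assumes lip: "\<And>i x y. norm (d i x - d i y) \<le> K * norm (x - y)"
    and dense: "closure S = UNIV"
    and S: "\<And>x. x \<in> S \<Longrightarrow> ((\<lambda>i. d i x) \<longlongrightarrow> 0) F"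
  shows "((\<lambda>i. d i x) \<longlongrightarrow> 0) F"
proof (rule tendstoI)
  fix e :: real assume e: "e > 0"
  \<comment> \<open>\<open>\<bar>K\<bar> + 1\<close> replaces K because nothing is known about the
    sign of K and a positive denominator is required.\<close>
  have pos: "e / (2 * (\<bar>K\<bar> + 1)) > 0" using e by simp
  then obtain y where y: "y \<in> S" "dist y x < e / (2 * (\<bar>K\<bar> + 1))"
    using dense closure_approachable by blast
  have "K * norm (x - y) \<le> (\<bar>K\<bar> + 1) * norm (x - y)" by (intro mult_right_mono) auto
  also have "\<dots> < e / 2" using y(2) by (simp add: dist_norm norm_minus_commute field_simps)
  finally have close: "norm (d i x - d i y) < e / 2" for i using lip[of i x y] by linarith
  have "\<forall>\<^sub>F i in F. norm (d i y) < e / 2"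
    using tendstoD[OF S[OF y(1)], of "e / 2"] e by simp
  then show "\<forall>\<^sub>F i in F. dist (d i x) 0 < e"
  proof eventually_elim
    case (elim i)
    then show ?case using close[of i] norm_triangle_sub[of "d i x" "d i y"] by simp
  qed
qed

text \<open>A letter keeps the index apart from the flag for the adjoint, so a permutation g acts on
  words by \<open>map_prod g id\<close> and the adjoint by reversing the word and negating the
  flags.\<close>

definition ladder :: "(nat \<Rightarrow> 'a::cstar_algebra) \<Rightarrow> nat \<times> bool \<Rightarrow> 'a" where
  "ladder a p = (if snd p then adj (a (fst p)) else a (fst p))"

definition monomial :: "(nat \<Rightarrow> 'a::cstar_algebra) \<Rightarrow> (nat \<times> bool) list \<Rightarrow> 'a" where
  "monomial a w = prod_list (map (ladder a) w)"

definition adj_word :: "(nat \<times> bool) list \<Rightarrow> (nat \<times> bool) list" where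
  "adj_word w = rev (map (map_prod id Not) w)"

lemma monomial_Nil [simp]: "monomial a [] = 1"
  and monomial_Cons: "monomial a (p # w) = ladder a p * monomial a w"
  and monomial_append: "monomial a (v @ w) = monomial a v * monomial a w"
  by (simp_all add: monomial_def)

lemma adj_ladder: "adj (ladder a p) = ladder a (map_prod id Not p)"
  by (cases p) (simp add: ladder_def adj_adj)

lemma adj_monomial: "adj (monomial a w) = monomial a (adj_word w)"
  by (induction w)
    (simp_all add: adj_word_def monomial_Cons monomial_append adj_mult adj_ladder)

lemma fst_set_adj_word [simp]: "fst ` set (adj_word w) = fst ` set w"
  by (simp add: adj_word_def image_image)

lemma length_adj_word [simp]: "length (adj_word w) = length w"
  by (simp add: adj_word_def)

text \<open>Powers of -1 are central in any ring, so the signs picked up by the two factors can be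
  collected in front and their exponents add.\<close>

lemma anticommute_prods:
  fixes p q r :: "'a::ring_1"
  assumes "p * r = (-1)^m * (r * p)" "q * r = (-1)^n * (r * q)"
  shows "(p * q) * r = (-1)^(m+n) * (r * (p * q))"
proof -
  have c: "x * (-1)^k = (-1)^k * x" for x :: 'a and k :: nat
    by (cases "even k") auto
  have "(p * q) * r = p * ((-1)^n * (r * q))" using assms(2) by (simp add: mult.assoc)
  also have "\<dots> = (-1)^n * ((p * r) * q)" by (metis c mult.assoc)
  also have "\<dots> = (-1)^n * ((-1)^m * (r * p) * q)" using assms(1) by simp
  also have "\<dots> = (-1)^(m+n) * (r * (p * q))"
    by (simp add: add.commute[of m] power_add mult.assoc)
  finally show ?thesis .
qed

section \<open>Signed commutation of monomials and density of their span\<close>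

locale car =
  fixes a :: "nat \<Rightarrow> 'a::cstar_algebra"
  assumes car: "car_algebra a"
begin

text \<open>\<open>span\<close> is the real linear span; putting the complex coefficients into the
  spanning set makes it a complex subspace.\<close>

definition monomial_span :: "'a set" where
  "monomial_span = span {c *\<^sub>C monomial a w | c w. fst ` set w \<subseteq> {1..}}"

lemma anticommute_adj:
  "j \<ge> 1 \<Longrightarrow> k \<ge> 1 \<Longrightarrow> adj (a j) * a k + a k * adj (a j) = (if j = k then 1 else 0)"
  using car unfolding car_algebra_def anticommutator_def by simp

lemma anticommute: "j \<ge> 1 \<Longrightarrow> k \<ge> 1 \<Longrightarrow> a j * a k + a k * a j = 0"
  using car unfolding car_algebra_def anticommutator_def by simp

lemma anticommute_adj_adj: "j \<ge> 1 \<Longrightarrow> k \<ge> 1 \<Longrightarrow> adj (a j) * adj (a k) + adj (a k) * adj (a j) = 0"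
  using car unfolding car_algebra_def anticommutator_def by simp

lemma ladder_anticommute:
  assumes "fst p \<ge> 1" "fst q \<ge> 1" "fst p \<noteq> fst q"
  shows "ladder a p * ladder a q = - (ladder a q * ladder a p)"
  using assms anticommute_adj[of "fst p" "fst q"] anticommute_adj[of "fst q" "fst p"]
    anticommute[of "fst p" "fst q"] anticommute_adj_adj[of "fst p" "fst q"]
  by (auto simp: ladder_def eq_neg_iff_add_eq_0 add.commute)

text \<open>Moving v past w takes \<open>length v * length w\<close> exchanges of letters with
  different indices, and each costs a sign.\<close>

lemma monomial_commute_disjoint:
  assumes "fst ` set v \<subseteq> {1..}" "fst ` set w \<subseteq> {1..}" "fst ` set v \<inter> fst ` set w = {}"
  shows "monomial a v * monomial a w = (-1)^(length v * length w) * (monomial a w * monomial a v)"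
proof -
  have one: "ladder a p * monomial a w = (-1)^(length w) * (monomial a w * ladder a p)"
    if "fst p \<ge> 1" "fst p \<notin> fst ` set w" for p
    using that assms(2)
  proof (induction w)
    case (Cons q w)
    have c: "x * (-1)^k = (-1)^k * x" for x :: 'a and k :: nat
      by (cases "even k") auto
    have "ladder a p * ladder a q = - (ladder a q * ladder a p)"
      using Cons by (intro ladder_anticommute) auto
    moreover have "ladder a p * monomial a w = (-1)^(length w) * (monomial a w * ladder a p)"
      using Cons by auto
    ultimately show ?case
      by (simp add: monomial_Cons mult.assoc[symmetric]) (simp add: mult.assoc c, metis c mult.assoc)
  qed simp
  show ?thesis
    using assms(1,3)
  proof (induction v)
    case (Cons p v)
    have "monomial a v * monomial a w = (-1)^(length v * length w) * (monomial a w * monomial a v)"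
      using Cons by auto
    moreover have "ladder a p * monomial a w = (-1)^(length w) * (monomial a w * ladder a p)"
      using Cons by (intro one) auto
    ultimately show ?case
      using anticommute_prods[of "ladder a p" "monomial a w" "length w" "monomial a v" "length v * length w"]
      by (simp add: monomial_Cons)
  qed simp
qed

lemma monomial_in_span: "fst ` set w \<subseteq> {1..} \<Longrightarrow> monomial a w \<in> monomial_span"
  unfolding monomial_span_def
  by (rule span_base, rule CollectI, rule exI[of _ 1], rule exI[of _ w]) simp

lemma monomial_span_add: "x \<in> monomial_span \<Longrightarrow> y \<in> monomial_span \<Longrightarrow> x + y \<in> monomial_span"
  unfolding monomial_span_def by (rule span_add)

text \<open>Reduces closure properties of the span to monomials. Real linearity is the right
  generality, since the adjoint is only conjugate linear over the complex numbers.\<close>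

lemma monomial_span_linear_image:
  assumes f: "linear f"
    and "\<And>c w. fst ` set w \<subseteq> {1..} \<Longrightarrow> f (c *\<^sub>C monomial a w) \<in> monomial_span"
    and x: "x \<in> monomial_span"
  shows "f x \<in> monomial_span"
proof -
  have "f ` {c *\<^sub>C monomial a w | c w. fst ` set w \<subseteq> {1..}} \<subseteq> monomial_span"
    using assms(2) by blast
  then have "span (f ` {c *\<^sub>C monomial a w | c w. fst ` set w \<subseteq> {1..}}) \<subseteq> monomial_span"
    unfolding monomial_span_def by (simp add: span_minimal)
  then show ?thesis
    using x unfolding monomial_span_def linear_span_image[OF f] by blast
qed

lemma monomial_span_scaleC: "x \<in> monomial_span \<Longrightarrow> c *\<^sub>C x \<in> monomial_span"
proof (rule monomial_span_linear_image[OF bounded_linear.linear[OF bounded_linear_scaleC_right]])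
  show "c *\<^sub>C d *\<^sub>C monomial a w \<in> monomial_span" if "fst ` set w \<subseteq> {1..}" for d w
    using that unfolding monomial_span_def scaleC_scaleC by (blast intro: span_base)
qed

lemma monomial_span_adj: "x \<in> monomial_span \<Longrightarrow> adj x \<in> monomial_span"
proof (rule monomial_span_linear_image[OF bounded_linear.linear[OF bounded_linear_adj]])
  show "adj (c *\<^sub>C monomial a w) \<in> monomial_span" if "fst ` set w \<subseteq> {1..}" for c w
    using that by (simp add: adj_scaleC adj_monomial monomial_span_scaleC monomial_in_span)
qed

lemma monomial_span_mult:
  assumes "x \<in> monomial_span" and y: "y \<in> monomial_span"
  shows "x * y \<in> monomial_span"
  using assms(1)
proof (rule monomial_span_linear_image[OF bounded_linear.linear[OF bounded_linear_mult_left], rotated])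
  fix c and v :: "(nat \<times> bool) list" assume v: "fst ` set v \<subseteq> {1..}"
  have "monomial a v * y \<in> monomial_span"
    using y
  proof (rule monomial_span_linear_image[OF bounded_linear.linear[OF bounded_linear_mult_right], rotated])
    fix d and w :: "(nat \<times> bool) list" assume "fst ` set w \<subseteq> {1..}"
    then show "monomial a v * d *\<^sub>C monomial a w \<in> monomial_span"
      using v monomial_in_span[of "v @ w"]
      by (simp add: mult_scaleC_right monomial_append monomial_span_scaleC image_Un)
  qed
  then show "c *\<^sub>C monomial a v * y \<in> monomial_span"
    by (simp add: mult_scaleC_left monomial_span_scaleC)
qed

text \<open>The closure is a C*-subalgebra containing the generators, and the algebra is the
  smallest such.\<close>

lemma closure_monomial_span: "closure monomial_span = UNIV"
proof -
  have "cstar_subalgebra (closure monomial_span)"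
    unfolding cstar_subalgebra_def
  proof (intro conjI ballI allI)
    show "1 \<in> closure monomial_span"
      using monomial_in_span[of "[]"] closure_subset by fastforce
  next
    fix x y assume "x \<in> closure monomial_span" "y \<in> closure monomial_span"
    then obtain f g where f: "\<And>n. f n \<in> monomial_span" "f \<longlonglongrightarrow> x"
      and g: "\<And>n. g n \<in> monomial_span" "g \<longlonglongrightarrow> y"
      unfolding closure_sequential by blast
    have "(\<lambda>n. f n + g n) \<longlonglongrightarrow> x + y" "(\<lambda>n. f n * g n) \<longlonglongrightarrow> x * y"
      using f g by (simp_all add: tendsto_add tendsto_mult)
    moreover have "\<And>n. f n + g n \<in> monomial_span" "\<And>n. f n * g n \<in> monomial_span"
      using f(1) g(1) by (simp_all add: monomial_span_add monomial_span_mult)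
    ultimately show "x + y \<in> closure monomial_span" "x * y \<in> closure monomial_span"
      unfolding closure_sequential
      by (simp_all add: exI[of _ "\<lambda>n. f n + g n"] exI[of _ "\<lambda>n. f n * g n"])
  next
    fix x assume "x \<in> closure monomial_span"
    then obtain f where f: "\<And>n. f n \<in> monomial_span" "f \<longlonglongrightarrow> x"
      unfolding closure_sequential by blast
    show "c *\<^sub>C x \<in> closure monomial_span" for c
      unfolding closure_sequential
      using f bounded_linear.tendsto[OF bounded_linear_scaleC_right]
      by (intro exI[of _ "\<lambda>n. c *\<^sub>C f n"]) (simp add: monomial_span_scaleC)
    show "adj x \<in> closure monomial_span"
      unfolding closure_sequential
      using f bounded_linear.tendsto[OF bounded_linear_adj]
      by (intro exI[of _ "\<lambda>n. adj (f n)"]) (simp add: monomial_span_adj)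
  qed simp
  moreover have "a ` {1..} \<union> (\<lambda>j. adj (a j)) ` {1..} \<subseteq> closure monomial_span"
  proof -
    have "ladder a (j, b) \<in> monomial_span" if "j \<ge> 1" for j b
      using monomial_in_span[of "[(j, b)]"] that by (simp add: monomial_Cons)
    from this[of _ False] this[of _ True] have "a ` {1..} \<union> (\<lambda>j. adj (a j)) ` {1..} \<subseteq> monomial_span"
      by (auto simp: ladder_def)
    then show ?thesis using closure_subset by blast
  qed
  ultimately have "cstar_generated (a ` {1..} \<union> (\<lambda>j. adj (a j)) ` {1..}) \<subseteq> closure monomial_span"
    unfolding cstar_generated_def by blast
  then show ?thesis using car unfolding car_algebra_def by auto
qed

text \<open>The common reduction to monomials. Seminorms cover norms of commutators as well as
  absolute values of linear functionals, and the general filter allows Cauchy sequences to be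
  treated through pairs of indices.\<close>

lemma seminorms_tendsto_zero:
  fixes p :: "'i \<Rightarrow> 'a \<Rightarrow> real"
  assumes nonneg: "\<And>i x. p i x \<ge> 0"
    and add: "\<And>i x y. p i (x + y) \<le> p i x + p i y"
    and scale: "\<And>i c x. p i (c *\<^sub>C x) \<le> cmod c * p i x"
    and bound: "\<And>i x. p i x \<le> K * norm x"
    and mon: "\<And>w. fst ` set w \<subseteq> {1..} \<Longrightarrow> ((\<lambda>i. p i (monomial a w)) \<longlongrightarrow> 0) F"
  shows "((\<lambda>i. p i x) \<longlongrightarrow> 0) F"
proof -
  have sc: "((\<lambda>i. p i (c *\<^sub>C y)) \<longlongrightarrow> 0) F" if "((\<lambda>i. p i y) \<longlongrightarrow> 0) F" for c y
  proof (rule tendsto_sandwich[OF _ _ tendsto_const])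
    show "((\<lambda>i. cmod c * p i y) \<longlongrightarrow> 0) F" using tendsto_mult_left[OF that, of "cmod c"] by simp
  qed (use nonneg scale in auto)
  have ad: "((\<lambda>i. p i (y + z)) \<longlongrightarrow> 0) F"
    if "((\<lambda>i. p i y) \<longlongrightarrow> 0) F" "((\<lambda>i. p i z) \<longlongrightarrow> 0) F" for y z
  proof (rule tendsto_sandwich[OF _ _ tendsto_const])
    show "((\<lambda>i. p i y + p i z) \<longlongrightarrow> 0) F" using tendsto_add[OF that] by simp
  qed (use nonneg add in auto)
  have sp: "((\<lambda>i. p i y) \<longlongrightarrow> 0) F" if "y \<in> monomial_span" for y
  proof (rule span_induct_alt[OF that[unfolded monomial_span_def]])
    have "p i 0 = 0" for i using bound[of i 0] nonneg[of i 0] by simp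
    then show "((\<lambda>i. p i 0) \<longlongrightarrow> 0) F" by simp
  next
    fix r x y
    assume "x \<in> {c *\<^sub>C monomial a w | c w. fst ` set w \<subseteq> {1..}}" and y: "((\<lambda>i. p i y) \<longlongrightarrow> 0) F"
    then obtain c w where "x = c *\<^sub>C monomial a w" "fst ` set w \<subseteq> {1..}" by blast
    then have "((\<lambda>i. p i (r *\<^sub>R x)) \<longlongrightarrow> 0) F"
      unfolding scaleC_of_real[symmetric] by (intro sc) (simp add: sc mon)
    then show "((\<lambda>i. p i (r *\<^sub>R x + y)) \<longlongrightarrow> 0) F" using ad y by blast
  qed
  \<comment> \<open>Scaling by -1 makes the seminorm symmetric, which the two-sided Lipschitz
    estimate below requires.\<close>
  have minus: "p i (x - y) = p i (y - x)" for i x y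
  proof -
    have "p i (- x) \<le> p i x" for x using scale[of i "-1" x] by (simp add: scaleC_minus_left)
    from this[of "x - y"] this[of "y - x"] show ?thesis by simp
  qed
  show ?thesis
  proof (rule tendsto_zero_of_dense[OF _ closure_monomial_span sp])
    show "norm (p i x - p i y) \<le> K * norm (x - y)" for i x y
      using add[of i "x - y" y] add[of i "y - x" x] minus[of i x y] bound[of i "x - y"] by simp
  qed
qed

end

section \<open>The action of finite permutations\<close>

lemma cstar_automorphism_id: "cstar_automorphism (id :: 'a::cstar_algebra \<Rightarrow> 'a)"
  by (simp add: cstar_automorphism_def)

lemma cstar_automorphism_comp:
  "cstar_automorphism f \<Longrightarrow> cstar_automorphism g \<Longrightarrow> cstar_automorphism (f \<circ> g)"
  by (simp add: cstar_automorphism_def bij_comp)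

text \<open>u is a self-adjoint unitary, so conjugation by it is its own inverse; a contraction with
  contractive inverse is isometric.\<close>

lemma cstar_automorphism_conj:
  fixes u :: "'a::cstar_algebra"
  assumes adj: "adj u = u" and sq: "u * u = 1"
  shows "cstar_automorphism (\<lambda>x. u * x * u)"
proof -
  have inv: "u * (u * x * u) * u = x" for x
  proof -
    have "u * (u * x * u) * u = (u * u) * x * (u * u)" by (simp only: mult.assoc)
    then show ?thesis by (simp add: sq)
  qed
  have "norm u = 1"
    using cstar_identity[of u] adj sq norm_ge_zero[of u] by (simp add: power2_eq_1_iff)
  then have le: "norm (u * x * u) \<le> norm x" for x
    using norm_mult_ineq[of "u * x" u] norm_mult_ineq[of u x] by simp
  show ?thesis
    unfolding cstar_automorphism_def
  proof (intro conjI allI)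
    show "bij (\<lambda>x. u * x * u)"
      by (rule o_bij[where g="\<lambda>x. u * x * u"]) (simp_all add: fun_eq_iff inv)
    fix x y c
    show "u * (x + y) * u = u * x * u + u * y * u" by (simp add: distrib_left distrib_right)
    show "u * (c *\<^sub>C x) * u = c *\<^sub>C (u * x * u)" by (simp add: mult_scaleC_left mult_scaleC_right)
    show "u * adj x * u = adj (u * x * u)" by (simp add: adj_mult adj mult.assoc)
    show "norm (u * x * u) = norm x" using le[of x] le[of "u * x * u"] by (simp add: inv)
    have "u * x * u * (u * y * u) = u * x * (u * u) * y * u" by (simp only: mult.assoc)
    then show "u * (x * y) * u = u * x * u * (u * y * u)" by (simp add: sq mult.assoc)
  qed
qed

context car
begin

text \<open>With \<open>b = a j - a k\<close>, the operator \<open>b\<^sup>* b / 2\<close> is a projection, and the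
  reflection \<open>1 - b\<^sup>* b\<close> changes the sign of \<open>b\<close> and commutes with \<open>a j + a k\<close>.\<close>

lemma transposition_implemented:
  assumes "j \<ge> 1" "k \<ge> 1" "j \<noteq> k"
  obtains u where "adj u = u" "u * u = 1"
    "\<And>i. i \<ge> 1 \<Longrightarrow> u * a i * u = a (Transposition.transpose j k i)"
proof -
  define b where "b = a j - a k"
  define u where "u = 1 - adj b * b"
  have bb: "b * b = 0"
  proof -
    have "a i * a i = 0" if "i \<ge> 1" for i
    proof -
      have "2 *\<^sub>R (a i * a i) = 0" using anticommute[OF that that] by (simp add: scaleR_2)
      then show ?thesis by simp
    qed
    moreover have "a j * a k = - (a k * a j)"
      using anticommute[OF assms(1,2)] by (simp add: eq_neg_iff_add_eq_0)
    ultimately show ?thesis using assms by (simp add: b_def algebra_simps)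
  qed
  have anti: "a i * b = - (b * a i)" if "i \<ge> 1" for i
  proof -
    have "a i * a j = - (a j * a i)" "a i * a k = - (a k * a i)"
      using anticommute[OF that assms(1)] anticommute[OF that assms(2)]
      by (simp_all add: eq_neg_iff_add_eq_0)
    then show ?thesis by (simp add: b_def left_diff_distrib right_diff_distrib)
  qed
  have adjb: "adj b * a i = (if i = j then 1 else if i = k then - 1 else 0) - a i * adj b"
    if "i \<ge> 1" for i
    using anticommute_adj[OF assms(1) that] anticommute_adj[OF assms(2) that] assms(3)
    by (auto simp: b_def adj_diff algebra_simps)
  \<comment> \<open>The anticommutator of b and its adjoint is 2, since each of the two generators
    contributes 1 and the mixed terms vanish. Together with \<open>b * b = 0\<close> this gives that
    \<open>adj b * b\<close> squares to twice itself.\<close>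
  have sum: "adj b * b = 2 - b * adj b"
  proof -
    have "adj b * b = adj b * a j - adj b * a k" by (metis b_def right_diff_distrib)
    also have "\<dots> = 2 - (a j * adj b - a k * adj b)"
      using adjb[OF assms(1)] adjb[OF assms(2)] assms(3) by simp
    also have "a j * adj b - a k * adj b = b * adj b" by (metis b_def left_diff_distrib)
    finally show ?thesis .
  qed
  have "adj u = u" by (simp add: u_def adj_diff adj_mult adj_adj)
  moreover have uu: "u * u = 1"
  proof -
    have "adj b * b * (adj b * b) = adj b * (b * adj b) * b" by (simp only: mult.assoc)
    also have "b * adj b = 2 - adj b * b" by (simp add: sum)
    also have "adj b * (2 - adj b * b) * b = 2 * (adj b * b) - adj b * adj b * (b * b)"
      by (simp add: algebra_simps mult_2 mult_2_right)
    finally have "adj b * b * (adj b * b) = 2 * (adj b * b)" by (simp add: bb)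
    then show ?thesis by (simp add: u_def algebra_simps mult_2)
  qed
  moreover have "u * a i * u = a (Transposition.transpose j k i)" if i: "i \<ge> 1" for i
  proof -
    have "adj b * b * a i = - (adj b * a i) * b"
    proof -
      have "b * a i = - (a i * b)" using anti[OF i] by simp
      then show ?thesis by (simp add: mult.assoc)
    qed
    also have "\<dots> = a i * (adj b * b) - (if i = j then b else if i = k then - b else 0)"
      by (simp add: adjb[OF i] left_diff_distrib mult.assoc)
    finally have eq: "u * a i = a i - a i * (adj b * b) + (if i = j then b else if i = k then - b else 0)"
      by (simp add: u_def left_diff_distrib)
    have bu: "b * u = - b"
    proof -
      have "b * u = b - (b * adj b) * b" by (simp add: u_def algebra_simps)
      also have "b * adj b = 2 - adj b * b" by (simp add: sum)
      finally show ?thesis by (simp add: algebra_simps bb mult_2)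
    qed
    \<comment> \<open>By \<open>eq\<close>, u commutes with \<open>a i\<close> up to a correction b,
      -b or 0. As \<open>b * u = - b\<close>, conjugation subtracts the correction, turning
      \<open>a j\<close> into \<open>a j - b = a k\<close> and \<open>a k\<close> into
      \<open>a k + b = a j\<close>.\<close>
    have "u * a i * u = a i * (u * u) + (if i = j then b else if i = k then - b else 0) * u"
      unfolding eq by (simp add: u_def algebra_simps)
    also have "\<dots> = a i - (if i = j then b else if i = k then - b else 0)"
      by (simp add: uu bu)
    also have "\<dots> = a (Transposition.transpose j k i)"
      using assms(3) by (auto simp: b_def Transposition.transpose_def)
    finally show ?thesis .
  qed
  ultimately show ?thesis using that by blast
qed

text \<open>A finitely supported permutation is a product of transpositions, and each of these is
  implemented by conjugation with a reflection.\<close>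

lemma ex_car_automorphism:
  assumes "g \<in> finite_perms"
  shows "\<exists>f. cstar_automorphism f \<and> (\<forall>j\<in>{1..}. f (a j) = a (g j))"
proof -
  define S where "S = {k. g k \<noteq> k}"
  have g: "g permutes {1..}" and fin: "finite S" using assms by (auto simp: finite_perms_def S_def)
  have S: "S \<subseteq> {1..}" using g by (auto simp: S_def permutes_def)
  \<comment> \<open>The induction over transpositions runs over a finite set, hence the passage from
    all positive integers to the support of g.\<close>
  have "g permutes S"
    by (rule permutes_superset[OF g]) (simp add: S_def)
  then show ?thesis
    using fin
  proof (induction rule: permutes_induct)
    case id
    show ?case using cstar_automorphism_id by fastforce
  next
    case (swap j k p)
    then obtain f where f: "cstar_automorphism f" "\<forall>i\<in>{1..}. f (a i) = a (p i)" by blast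
    obtain u where u: "adj u = u" "u * u = 1"
      "\<And>i. i \<ge> 1 \<Longrightarrow> u * a i * u = a (Transposition.transpose j k i)"
      using transposition_implemented[of j k] swap S by auto
    have "p permutes {1..}" using swap S permutes_subset by blast
    then have "p i \<ge> 1" if "i \<ge> 1" for i using that permutes_in_image[of p "{1..}" i] by simp
    then show ?case
      using f(2) u(3)
      by (intro exI[of _ "(\<lambda>x. u * x * u) \<circ> f"] conjI
          cstar_automorphism_comp[OF cstar_automorphism_conj[OF u(1,2)] f(1)]) simp
  qed
qed

lemma automorphism_monomial:
  assumes f: "cstar_automorphism f" "\<forall>j\<in>{1..}. f (a j) = a (g j)" and w: "fst ` set w \<subseteq> {1..}"
  shows "f (monomial a w) = monomial a (map (map_prod g id) w)"
  using w
proof (induction w)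
  case Nil
  have "f 1 = 1"
  proof -
    obtain y where "f y = 1" using f unfolding cstar_automorphism_def bij_def by (metis surjD)
    moreover have "f (1 * y) = f 1 * f y" using f unfolding cstar_automorphism_def by blast
    ultimately show ?thesis by simp
  qed
  then show ?case by simp
next
  case (Cons p w)
  then have "f (ladder a p) = ladder a (map_prod g id p)"
    using f by (cases p) (auto simp: ladder_def cstar_automorphism_def)
  then show ?case using Cons f by (simp add: monomial_Cons cstar_automorphism_def id_def)
qed

text \<open>Both maps agree on monomials, which are determined by the generators, and both are
  isometric, so density applies to the norm of their difference, taken as a constant
  sequence.\<close>

lemma car_automorphism_unique:
  assumes f: "cstar_automorphism f" "\<forall>j\<in>{1..}. f (a j) = a (g j)"
    and f': "cstar_automorphism f'" "\<forall>j\<in>{1..}. f' (a j) = a (g j)"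
  shows "f = f'"
proof
  fix x
  have "((\<lambda>i::nat. norm (f x - f' x)) \<longlongrightarrow> 0) sequentially"
  proof (rule seminorms_tendsto_zero[where K=2 and p="\<lambda>_ x. norm (f x - f' x)"])
    show "norm (f (x + y) - f' (x + y)) \<le> norm (f x - f' x) + norm (f y - f' y)" for x y
      using f f' norm_triangle_ineq[of "f x - f' x" "f y - f' y"]
      by (simp add: cstar_automorphism_def algebra_simps)
    show "norm (f (c *\<^sub>C x) - f' (c *\<^sub>C x)) \<le> cmod c * norm (f x - f' x)" for c x
      using f f' by (simp add: cstar_automorphism_def scaleC_diff_right[symmetric] norm_scaleC)
    show "norm (f x - f' x) \<le> 2 * norm x" for x
      using f f' norm_triangle_ineq4[of "f x" "f' x"] by (simp add: cstar_automorphism_def)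
  qed (simp_all add: automorphism_monomial[OF f] automorphism_monomial[OF f'])
  then show "f x = f' x" by (simp add: LIMSEQ_const_iff)
qed

lemma car_action:
  assumes "g \<in> finite_perms"
  shows cstar_automorphism_car_action: "cstar_automorphism (car_action a g)"
    and car_action_generator: "\<forall>j\<in>{1..}. car_action a g (a j) = a (g j)"
proof -
  have "\<exists>!f. cstar_automorphism f \<and> (\<forall>j\<in>{1..}. f (a j) = a (g j))"
    using ex_car_automorphism[OF assms] car_automorphism_unique by blast
  from theI'[OF this] show "cstar_automorphism (car_action a g)"
    "\<forall>j\<in>{1..}. car_action a g (a j) = a (g j)" unfolding car_action_def by auto
qed

lemma car_action_add: "g \<in> finite_perms \<Longrightarrow> car_action a g (x + y) = car_action a g x + car_action a g y"
  and car_action_scaleC: "g \<in> finite_perms \<Longrightarrow> car_action a g (c *\<^sub>C x) = c *\<^sub>C car_action a g x"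
  and car_action_mult: "g \<in> finite_perms \<Longrightarrow> car_action a g (x * y) = car_action a g x * car_action a g y"
  and car_action_adj: "g \<in> finite_perms \<Longrightarrow> car_action a g (adj x) = adj (car_action a g x)"
  and norm_car_action: "g \<in> finite_perms \<Longrightarrow> norm (car_action a g x) = norm x"
proof -
  assume "g \<in> finite_perms"
  note f = cstar_automorphism_car_action[OF this, unfolded cstar_automorphism_def]
  show "car_action a g (x + y) = car_action a g x + car_action a g y"
    "car_action a g (c *\<^sub>C x) = c *\<^sub>C car_action a g x"
    "car_action a g (x * y) = car_action a g x * car_action a g y"
    "car_action a g (adj x) = adj (car_action a g x)"
    "norm (car_action a g x) = norm x"
    using f by blast+
qed

lemma car_action_monomial:
  "g \<in> finite_perms \<Longrightarrow> fst ` set w \<subseteq> {1..} \<Longrightarrow>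
    car_action a g (monomial a w) = monomial a (map (map_prod g id) w)"
  using automorphism_monomial car_action by blast

end

text \<open>One formula for two uses: \<open>block_swap\<close> is the case of two adjacent blocks
  starting at 1, and blocks far apart give the permutations that carry one shifted word to
  another.\<close>

definition swap_blocks :: "nat \<Rightarrow> nat \<Rightarrow> nat \<Rightarrow> nat \<Rightarrow> nat" where
  "swap_blocks p q m k =
     (if p < k \<and> k \<le> p + m then k - p + q else if q < k \<and> k \<le> q + m then k - q + p else k)"

lemma swap_blocks_in_finite_perms:
  assumes "p + m \<le> q"
  shows "swap_blocks p q m \<in> finite_perms"
proof -
  have inv: "swap_blocks p q m (swap_blocks p q m k) = k" for k
    using assms by (auto simp: swap_blocks_def)
  have "swap_blocks p q m permutes {1..}"
    unfolding permutes_def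
  proof (intro conjI allI impI)
    show "\<exists>!x. swap_blocks p q m x = y" for y by (metis inv)
  qed (simp add: swap_blocks_def)
  moreover have "{k. swap_blocks p q m k \<noteq> k} \<subseteq> {..q + m}"
    using assms by (auto simp: swap_blocks_def)
  ultimately show ?thesis unfolding finite_perms_def using finite_subset by blast
qed

text \<open>The successor removes the truncated subtraction \<open>n - 1\<close>. At index 0 the
  formula sends 1 to 2 and also fixes 2, so it is no permutation; the limits below discard that
  index.\<close>

lemma block_swap_Suc: "block_swap (Suc n) = swap_blocks 0 (2 ^ n) (2 ^ n)"
  by (auto simp: block_swap_def swap_blocks_def fun_eq_iff)

lemma block_swap_in_finite_perms: "block_swap (Suc n) \<in> finite_perms"
  unfolding block_swap_Suc by (rule swap_blocks_in_finite_perms) simp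

lemma block_swap_le: "1 \<le> k \<Longrightarrow> k \<le> 2 ^ n \<Longrightarrow> block_swap (Suc n) k = 2 ^ n + k"
  by (simp add: block_swap_Suc swap_blocks_def)

section \<open>Invariant functionals dominated by an extreme symmetric state\<close>

lemma cinner_zero_left [simp]: "cinner (0::'h::complex_hilbert_space) y = 0"
  using cinner_scaleC_left[of 0 "0::'h" y] by simp

lemma cinner_minus_left: "cinner (- x) y = - cinner (x::'h::complex_hilbert_space) y"
  using cinner_scaleC_left[of "-1" x y] by (simp add: scaleC_minus_left)

lemma cinner_diff_left: "cinner (x - y) z = cinner x z - cinner (y::'h::complex_hilbert_space) z"
  using cinner_add_left[of x "-y" z] by (simp add: cinner_minus_left)

lemma cinner_diff_right: "cinner z (x - y) = cinner z x - cinner z (y::'h::complex_hilbert_space)"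
  using cinner_commute[of z "x - y"] cinner_commute[of z x] cinner_commute[of z y]
  by (simp add: cinner_diff_left)

lemma cinner_scaleC_right: "cinner x (c *\<^sub>C y) = cnj c * cinner x (y::'h::complex_hilbert_space)"
  using cinner_commute[of x "c *\<^sub>C y"] cinner_commute[of x y] by (simp add: cinner_scaleC_left)

lemma cinner_Cauchy_Schwarz: "cmod (cinner x y) \<le> norm x * norm (y::'h::complex_hilbert_space)"
proof (cases "y = 0")
  case True
  then show ?thesis using cinner_commute[of x y] by simp
next
  case False
  \<comment> \<open>\<open>c *\<^sub>C y\<close> is the orthogonal projection of x onto the line
    through y.\<close>
  define c where "c = cinner x y / complex_of_real ((norm y)\<^sup>2)"
  have y: "norm y > 0" using False by simp
  have "cinner (x - c *\<^sub>C y) (x - c *\<^sub>C y) =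
      cinner x x - cnj c * cinner x y - c * (cinner y x - cnj c * cinner y y)"
    by (simp add: cinner_diff_left cinner_diff_right cinner_scaleC_left cinner_scaleC_right
        algebra_simps)
  also have "cinner y x - cnj c * cinner y y = 0"
    using y cinner_commute[of y x] by (simp add: c_def cinner_self)
  also have "cnj c * cinner x y = complex_of_real ((cmod (cinner x y))\<^sup>2 / (norm y)\<^sup>2)"
    by (simp add: c_def complex_norm_square mult.commute del: of_real_power)
  finally have "complex_of_real ((norm (x - c *\<^sub>C y))\<^sup>2) =
      complex_of_real ((norm x)\<^sup>2 - (cmod (cinner x y))\<^sup>2 / (norm y)\<^sup>2)"
    by (simp add: cinner_self del: of_real_power)
  then have "(norm (x - c *\<^sub>C y))\<^sup>2 = (norm x)\<^sup>2 - (cmod (cinner x y))\<^sup>2 / (norm y)\<^sup>2"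
    unfolding of_real_eq_iff .
  then have "(cmod (cinner x y))\<^sup>2 / (norm y)\<^sup>2 \<le> (norm x)\<^sup>2"
    using zero_le_power2[of "norm (x - c *\<^sub>C y)"] by linarith
  then have "(cmod (cinner x y))\<^sup>2 \<le> (norm x * norm y)\<^sup>2"
    using y by (simp add: divide_le_eq power_mult_distrib)
  then show ?thesis by (rule power2_le_imp_le) simp
qed

definition hermitian_adjoint :: "('a::cstar_algebra \<Rightarrow> complex) \<Rightarrow> 'a \<Rightarrow> complex" where
  "hermitian_adjoint f = (\<lambda>x. cnj (f (adj x)))"

context car
begin

text \<open>Kept as plain functions because the functionals of interest arise as pointwise limits or
  as matrix coefficients; membership in the dual space matters only where extremality is
  invoked.\<close>

definition invariant_functional :: "('a \<Rightarrow> complex) \<Rightarrow> bool" where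
  "invariant_functional f \<longleftrightarrow> bounded_linear f \<and> (\<forall>c x. f (c *\<^sub>C x) = c * f x) \<and>
     (\<forall>g\<in>finite_perms. \<forall>x. f (car_action a g x) = f x)"

lemma invariant_functional_add:
  "invariant_functional f \<Longrightarrow> invariant_functional f' \<Longrightarrow> invariant_functional (\<lambda>x. f x + f' x)"
  unfolding invariant_functional_def by (auto simp: bounded_linear_add distrib_left)

lemma invariant_functional_mult:
  "invariant_functional f \<Longrightarrow> invariant_functional (\<lambda>x. c * f x)"
  unfolding invariant_functional_def
  by (auto simp: mult.left_commute intro: bounded_linear_compose[OF bounded_linear_mult_right])

lemma invariant_functional_hermitian_adjoint:
  assumes "invariant_functional f"
  shows "invariant_functional (hermitian_adjoint f)"
proof -
  have "bounded_linear (\<lambda>x. cnj (f (adj x)))"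
    using assms bounded_linear_compose[OF bounded_linear_cnj
        bounded_linear_compose[OF _ bounded_linear_adj]]
    unfolding invariant_functional_def by blast
  then show ?thesis
    using assms
    by (simp add: invariant_functional_def hermitian_adjoint_def adj_scaleC car_action_adj[symmetric])
qed

end

locale extreme_symmetric_state = car a for a :: "nat \<Rightarrow> 'a::cstar_algebra" +
  fixes \<phi> :: "'a \<Rightarrow>\<^sub>L complex"
  assumes extreme: "\<phi> extreme_point_of (symmetric_states a)"
begin

lemma symmetric: "\<phi> \<in> symmetric_states a"
  using extreme unfolding extreme_point_of_def by blast

lemma state_scaleC: "\<phi> (c *\<^sub>C x) = c * \<phi> x"
  and state_pos: "\<phi> (adj x * x) \<in> \<real>\<^sub>\<ge>\<^sub>0"
  and state_one: "\<phi> 1 = 1"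
  and state_invariant: "g \<in> finite_perms \<Longrightarrow> \<phi> (car_action a g x) = \<phi> x"
  using symmetric unfolding symmetric_states_def states_def by blast+

lemma invariant_functional_state: "invariant_functional (blinfun_apply \<phi>)"
  unfolding invariant_functional_def
  by (simp add: state_scaleC state_invariant blinfun.bounded_linear_right)

text \<open>Reality of \<open>h (adj x * x)\<close> and the domination by \<phi> keep the perturbed
  functionals positive, \<open>h 1 = 0\<close> keeps them normalized, and invariance keeps them
  symmetric.\<close>

lemma hermitian_invariant_functional_zero:
  assumes h: "invariant_functional h" and h1: "h 1 = 0"
    and real: "\<And>x. h (adj x * x) \<in> \<real>"
    and le: "\<And>x. cmod (h (adj x * x)) \<le> K * Re (\<phi> (adj x * x))"
  shows "h x = 0"
proof -
  \<comment> \<open>Small enough that k times \<open>\<bar>h (adj x * x)\<bar>\<close> stays below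
    \<open>\<phi> (adj x * x)\<close>, and positive whatever the sign of K.\<close>
  define k where "k = 1 / (\<bar>K\<bar> + 1)"
  define H where "H = Blinfun h"
  have k: "k > 0" by (simp add: k_def)
  have H: "blinfun_apply H = h"
    using h unfolding H_def invariant_functional_def by (simp add: bounded_linear_Blinfun_apply)
  have state: "\<phi> + (s * k) *\<^sub>R H \<in> symmetric_states a" if s: "\<bar>s\<bar> = 1" for s :: real
  proof -
    have H_app: "(\<phi> + (s * k) *\<^sub>R H) y = \<phi> y + complex_of_real (s * k) * h y" for y
      by (simp add: blinfun.add_left blinfun.scaleR_left H scaleR_conv_of_real)
    have "(\<phi> + (s * k) *\<^sub>R H) (adj y * y) \<in> \<real>\<^sub>\<ge>\<^sub>0" for y
    proof -
      define r where "r = Re (\<phi> (adj y * y))"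
      define t where "t = Re (h (adj y * y))"
      have "\<phi> (adj y * y) = complex_of_real r" "r \<ge> 0"
        using state_pos[of y] by (auto simp: r_def complex_nonneg_Reals_iff complex_eq_iff)
      moreover have ht: "h (adj y * y) = complex_of_real t"
        using real[of y] by (simp add: t_def)
      ultimately have eq: "(\<phi> + (s * k) *\<^sub>R H) (adj y * y) = complex_of_real (r + s * k * t)"
        unfolding H_app by simp
      have "\<bar>t\<bar> \<le> K * r" using le[of y] ht by (simp add: r_def)
      also have "\<dots> \<le> (\<bar>K\<bar> + 1) * r" using \<open>r \<ge> 0\<close> by (intro mult_right_mono) auto
      finally have "k * \<bar>t\<bar> \<le> r" by (simp add: k_def field_simps)
      moreover have "\<bar>s * k * t\<bar> = k * \<bar>t\<bar>" using s k by (simp add: abs_mult)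
      ultimately have "r + s * k * t \<ge> 0" by linarith
      then show ?thesis unfolding eq by (simp add: complex_nonneg_Reals_iff)
    qed
    moreover have "(\<phi> + (s * k) *\<^sub>R H) (c *\<^sub>C y) = c * (\<phi> + (s * k) *\<^sub>R H) y" for c y
      using h unfolding H_app invariant_functional_def by (simp add: state_scaleC algebra_simps)
    moreover have "(\<phi> + (s * k) *\<^sub>R H) 1 = 1" unfolding H_app by (simp add: state_one h1)
    moreover have "(\<phi> + (s * k) *\<^sub>R H) (car_action a g y) = (\<phi> + (s * k) *\<^sub>R H) y"
      if "g \<in> finite_perms" for g y
      using h that unfolding H_app invariant_functional_def by (simp add: state_invariant)
    ultimately show ?thesis unfolding symmetric_states_def states_def by blast
  qed
  let ?p = "\<phi> + k *\<^sub>R H" and ?m = "\<phi> - k *\<^sub>R H"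
  have "?p \<in> symmetric_states a" "?m \<in> symmetric_states a"
    using state[of 1] state[of "-1"] by simp_all
  moreover have "midpoint ?p ?m = \<phi>"
    by (simp add: midpoint_def scaleR_add_right[symmetric] scaleR_2[symmetric])
  \<comment> \<open>If the two states differed, their midpoint \<phi> would lie in the open segment
    between them.\<close>
  ultimately have "?p = ?m"
    using extreme midpoint_in_open_segment[of ?p ?m] unfolding extreme_point_of_def by metis
  then have "k *\<^sub>R H + k *\<^sub>R H = 0" by (simp add: eq_diff_eq add.assoc)
  then have "2 *\<^sub>R (k *\<^sub>R H) = 0" by (simp only: scaleR_2)
  then have "H = 0" using k by simp
  then show ?thesis using H by (metis zero_blinfun.rep_eq)
qed

text \<open>A Radon-Nikodym argument for functionals: d is f minus its candidate value, vanishes at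
  1 and is still dominated by \<phi>. Its hermitian and antihermitian parts are treated separately,
  because only perturbations that are real on positive elements can preserve states.\<close>

lemma invariant_functional_eq_multiple:
  assumes f: "invariant_functional f"
    and le: "\<And>x. cmod (f (adj x * x)) \<le> K * Re (\<phi> (adj x * x))"
  shows "f x = f 1 * \<phi> x"
proof -
  define d where "d = (\<lambda>x. f x + (- f 1) * \<phi> x)"
  have d: "invariant_functional d"
    unfolding d_def
    by (intro invariant_functional_add invariant_functional_mult f invariant_functional_state)
  have d1: "d 1 = 0" by (simp add: d_def state_one)
  have d_le: "cmod (d (adj x * x)) \<le> (K + cmod (f 1)) * Re (\<phi> (adj x * x))" for x
  proof -
    have "cmod (\<phi> (adj x * x)) = Re (\<phi> (adj x * x))"
      using state_pos[of x] by (simp add: complex_nonneg_Reals_iff cmod_eq_Re)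
    then show ?thesis
      using le[of x] norm_triangle_ineq[of "f (adj x * x)" "(- f 1) * \<phi> (adj x * x)"]
      by (simp add: d_def norm_mult distrib_right)
  qed
  have star: "hermitian_adjoint d (adj x * x) = cnj (d (adj x * x))" for x
    by (simp add: hermitian_adjoint_def adj_mult adj_adj)
  have star1: "hermitian_adjoint d 1 = 0" by (simp add: hermitian_adjoint_def d1)
  note inv = invariant_functional_add[OF d invariant_functional_hermitian_adjoint[OF d]]
    invariant_functional_mult[OF invariant_functional_add[OF d
      invariant_functional_mult[OF invariant_functional_hermitian_adjoint[OF d], of "-1"]], of \<i>]
  have bound: "cmod (d (adj x * x)) + cmod (d (adj x * x))
      \<le> 2 * (K + cmod (f 1)) * Re (\<phi> (adj x * x))" for x
    using d_le[of x] by linarith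
  have "d x + hermitian_adjoint d x = 0"
  proof (rule hermitian_invariant_functional_zero[OF inv(1)])
    show "d (adj x * x) + hermitian_adjoint d (adj x * x) \<in> \<real>" for x
      by (simp add: star complex_is_Real_iff)
    show "cmod (d (adj x * x) + hermitian_adjoint d (adj x * x))
        \<le> 2 * (K + cmod (f 1)) * Re (\<phi> (adj x * x))" for x
      using bound[of x] norm_triangle_ineq[of "d (adj x * x)" "cnj (d (adj x * x))"]
      by (simp add: star)
  qed (simp add: d1 star1)
  \<comment> \<open>The factor \<open>\<i>\<close> turns the antihermitian part of d into a
    hermitian functional.\<close>
  moreover have "\<i> * (d x + (-1) * hermitian_adjoint d x) = 0"
  proof (rule hermitian_invariant_functional_zero[OF inv(2)])
    show "\<i> * (d (adj x * x) + (-1) * hermitian_adjoint d (adj x * x)) \<in> \<real>" for x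
      by (simp add: star complex_is_Real_iff)
    show "cmod (\<i> * (d (adj x * x) + (-1) * hermitian_adjoint d (adj x * x)))
        \<le> 2 * (K + cmod (f 1)) * Re (\<phi> (adj x * x))" for x
      using bound[of x] norm_triangle_ineq4[of "d (adj x * x)" "cnj (d (adj x * x))"]
      by (simp add: star norm_mult)
  qed (simp add: d1 star1)
  ultimately have "d x = 0" by simp
  then show ?thesis by (simp add: d_def)
qed

end

section \<open>Matrix coefficients of shifted elements\<close>

text \<open>The effect of \<open>block_swap (Suc n)\<close> on words whose indices lie in the first
  \<open>2 ^ n\<close> positions, where the swap is a translation.\<close>

definition shift_word :: "nat \<Rightarrow> (nat \<times> bool) list \<Rightarrow> (nat \<times> bool) list" where
  "shift_word n w = map (map_prod (\<lambda>k. 2 ^ n + k) id) w"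

lemma set_shift_word: "fst ` set w \<subseteq> {1..k} \<Longrightarrow> fst ` set (shift_word n w) \<subseteq> {2 ^ n + 1..2 ^ n + k}"
  by (force simp: shift_word_def)

lemma length_shift_word [simp]: "length (shift_word n w) = length w"
  by (simp add: shift_word_def)

lemma nat_le_two_power: "k \<le> n \<Longrightarrow> k \<le> (2::nat) ^ n"
  using less_exp[of n] by linarith

lemma ex_word_bound: "fst ` set w \<subseteq> {1..} \<Longrightarrow> \<exists>k. fst ` set w \<subseteq> {1..k::nat}"
proof -
  assume w: "fst ` set w \<subseteq> {1..}"
  obtain k where "\<forall>j\<in>fst ` set w. j \<le> k"
    using finite_nat_set_iff_bounded_le[of "fst ` set w"] by (meson finite_imageI finite_set)
  with w have "fst ` set w \<subseteq> {1..k}" by fastforce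
  then show ?thesis ..
qed

lemma word_bound_mono: "fst ` set w \<subseteq> {1..k::nat} \<Longrightarrow> k \<le> k' \<Longrightarrow> fst ` set w \<subseteq> {1..k'}"
  by force

lemma cmod_limit_le:
  fixes f :: "nat \<Rightarrow> complex"
  assumes "f \<longlonglongrightarrow> l" "\<And>n. cmod (f n) \<le> c"
  shows "cmod l \<le> c"
  using tendsto_upperbound[OF tendsto_norm[OF assms(1)]] assms(2) by simp

locale gns_extreme_state = extreme_symmetric_state a \<phi>
  for a :: "nat \<Rightarrow> 'a::cstar_algebra" and \<phi> +
  fixes \<pi> :: "'a \<Rightarrow> 'h::complex_hilbert_space \<Rightarrow> 'h" and \<Omega> :: 'h
    and U :: "(nat \<Rightarrow> nat) \<Rightarrow> 'h \<Rightarrow> 'h"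
  assumes gns: "gns_triple \<phi> \<pi> \<Omega>" and impl: "gns_implementation a \<pi> \<Omega> U"
begin

section \<open>The GNS vectors: matrix coefficients, norms and cyclicity\<close>

lemma rep_bounded_op: "\<pi> A \<in> bounded_ops"
  and rep_one: "\<pi> 1 = id"
  and rep_add: "\<pi> (A + B) x = \<pi> A x + \<pi> B x"
  and rep_scaleC: "\<pi> (c *\<^sub>C A) x = c *\<^sub>C \<pi> A x"
  and rep_mult: "\<pi> (A * B) x = \<pi> A (\<pi> B x)"
  and rep_adj: "cinner (\<pi> A x) y = cinner x (\<pi> (adj A) y)"
  and cyclic: "closure (range (\<lambda>A. \<pi> A \<Omega>)) = UNIV"
  and vector_state: "cinner (\<pi> A \<Omega>) \<Omega> = \<phi> A"
  using gns unfolding gns_triple_def star_representation_def by auto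

lemma rep_bounded_linear: "bounded_linear (\<pi> A)"
  and rep_vec_scaleC: "\<pi> A (c *\<^sub>C x) = c *\<^sub>C \<pi> A x"
  using rep_bounded_op[of A] unfolding bounded_ops_def by auto

lemma rep_norm_le: "norm (\<pi> A x) \<le> onorm (\<pi> A) * norm x"
  by (rule onorm[OF rep_bounded_linear])

lemma rep_zero: "\<pi> 0 x = 0"
  using rep_add[of 0 0 x] by simp

lemma matrix_coefficient: "cinner (\<pi> A (\<pi> B \<Omega>)) (\<pi> C \<Omega>) = \<phi> (adj C * A * B)"
proof -
  have "cinner (\<pi> A (\<pi> B \<Omega>)) (\<pi> C \<Omega>) = cinner (\<pi> (adj C) (\<pi> A (\<pi> B \<Omega>))) \<Omega>"
    by (simp add: rep_adj adj_adj)
  then show ?thesis by (simp add: rep_mult[symmetric] vector_state mult.assoc)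
qed

lemma norm_rep_cyclic: "(norm (\<pi> A \<Omega>))\<^sup>2 = Re (\<phi> (adj A * A))"
proof -
  have "complex_of_real ((norm (\<pi> A \<Omega>))\<^sup>2) = \<phi> (adj A * A)"
    using matrix_coefficient[of 1 A A] by (simp add: rep_one cinner_self)
  then show ?thesis by (metis Re_complex_of_real)
qed

text \<open>The constant comes from \<open>norm \<phi> \<le> (norm \<phi> + 1)\<^sup>2\<close>, so
  that the bound on the squared norm has a plain square root.\<close>

lemma norm_rep_cyclic_le: "norm (\<pi> A \<Omega>) \<le> (norm \<phi> + 1) * norm A"
proof (rule power2_le_imp_le)
  have "(norm (\<pi> A \<Omega>))\<^sup>2 \<le> cmod (\<phi> (adj A * A))"
    unfolding norm_rep_cyclic by (rule complex_Re_le_cmod)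
  also have "\<dots> \<le> norm \<phi> * norm (adj A * A)" by (rule norm_blinfun)
  also have "\<dots> \<le> (norm \<phi> + 1)\<^sup>2 * (norm A)\<^sup>2"
    unfolding cstar_identity
  proof (intro mult_right_mono)
    show "norm \<phi> \<le> (norm \<phi> + 1)\<^sup>2"
      using zero_le_power2[of "norm \<phi>"] norm_ge_zero[of \<phi>] unfolding power2_sum by simp
  qed simp
  finally show "(norm (\<pi> A \<Omega>))\<^sup>2 \<le> ((norm \<phi> + 1) * norm A)\<^sup>2" by (simp add: power_mult_distrib)
qed simp

lemma norm_cyclic: "norm \<Omega> = 1"
proof -
  have "(norm \<Omega>)\<^sup>2 = 1" using norm_rep_cyclic[of 1] by (simp add: rep_one state_one)
  then show ?thesis using norm_ge_zero[of \<Omega>] by (simp add: power2_eq_1_iff)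
qed

lemma cinner_cyclic: "cinner \<Omega> \<Omega> = 1"
  by (simp add: cinner_self norm_cyclic)

lemma eq_zero_of_orthogonal:
  assumes "\<And>A. cinner x (\<pi> A \<Omega>) = 0"
  shows "x = 0"
proof -
  have "((\<lambda>_::nat. cinner x y) \<longlongrightarrow> 0) sequentially" for y
    by (rule tendsto_zero_of_dense[where d="\<lambda>_ y. cinner x y" and K="norm x", OF _ cyclic])
      (auto simp: assms cinner_diff_right[symmetric] cinner_Cauchy_Schwarz)
  then have "cinner x x = 0" by (simp add: LIMSEQ_const_iff)
  then show ?thesis by (simp add: cinner_self)
qed

lemma bounded_ops_eqI:
  assumes S: "S \<in> bounded_ops" and T: "T \<in> bounded_ops"
    and eq: "\<And>A. S (\<pi> A \<Omega>) = T (\<pi> A \<Omega>)"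
  shows "S = T"
proof
  fix x
  have bl: "bounded_linear (\<lambda>x. S x - T x)"
    using S T unfolding bounded_ops_def by (simp add: bounded_linear_sub)
  have "((\<lambda>_::nat. S x - T x) \<longlongrightarrow> 0) sequentially"
  proof (rule tendsto_zero_of_dense[where d="\<lambda>_ x. S x - T x", OF _ cyclic])
    show "norm ((S x - T x) - (S y - T y)) \<le> onorm (\<lambda>x. S x - T x) * norm (x - y)" for x y
      using onorm[OF bl, of "x - y"] bounded_linear.linear[OF bl, THEN linear_diff, of x y] by simp
  qed (auto simp: eq)
  then show "S x = T x" by (simp add: LIMSEQ_const_iff)
qed

section \<open>The unitaries implementing the permutations\<close>

context
  fixes g assumes g: "g \<in> finite_perms"
begin

lemma unitary_scaleC: "U g (c *\<^sub>C x) = c *\<^sub>C U g x"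
  and unitary_cinner: "cinner (U g x) (U g y) = cinner x y"
  and unitary_surj: "surj (U g)"
  and unitary_diff: "U g (x - y) = U g x - U g y"
  and unitary_cyclic: "U g \<Omega> = \<Omega>"
  and unitary_implements: "\<pi> (car_action a g A) = U g \<circ> \<pi> A \<circ> inv (U g)"
  using impl g unfolding gns_implementation_def unitary_op_def bounded_ops_def
  by (auto simp: linear_diff bounded_linear.linear)

lemma unitary_norm: "norm (U g x) = norm x"
  using unitary_cinner[of x x] unfolding cinner_self of_real_eq_iff by simp

lemma unitary_inv: "inv (U g) (U g x) = x"
proof -
  have "inj (U g)"
  proof (rule injI)
    fix x y assume "U g x = U g y"
    then have "norm (x - y) = 0" using unitary_norm[of "x - y"] unitary_diff by simp
    then show "x = y" by simp
  qed
  then show ?thesis by simp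
qed

lemma unitary_inv_right: "U g (inv (U g) x) = x"
  using unitary_surj by (rule surj_f_inv_f)

text \<open>Conjugation by a unitary preserves the operator norm, so the bound does not depend on g.
  This uniformity makes the density arguments possible and supplies the constant in the domination
  by \<phi>.\<close>

lemma norm_rep_car_action_le: "norm (\<pi> (car_action a g A) x) \<le> onorm (\<pi> A) * norm x"
proof -
  have "norm (\<pi> (car_action a g A) x) = norm (\<pi> A (inv (U g) x))"
    by (simp add: unitary_implements unitary_norm)
  also have "\<dots> \<le> onorm (\<pi> A) * norm (inv (U g) x)" by (rule rep_norm_le)
  also have "norm (inv (U g) x) = norm x" by (metis unitary_norm unitary_inv_right)
  finally show ?thesis .
qed

end

text \<open>The offset makes \<open>shift n\<close> translate the first \<open>2 ^ n\<close> indices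
  by \<open>2 ^ n\<close>, without subtraction in the exponent.\<close>

definition shift :: "nat \<Rightarrow> 'a \<Rightarrow> 'a" where
  "shift n = car_action a (block_swap (Suc n))"

lemmas shift_add = car_action_add[OF block_swap_in_finite_perms, folded shift_def]
  and shift_scaleC = car_action_scaleC[OF block_swap_in_finite_perms, folded shift_def]
  and shift_adj = car_action_adj[OF block_swap_in_finite_perms, folded shift_def]
  and norm_shift = norm_car_action[OF block_swap_in_finite_perms, folded shift_def]
  and state_shift = state_invariant[OF block_swap_in_finite_perms, folded shift_def]
  and norm_rep_shift_le = norm_rep_car_action_le[OF block_swap_in_finite_perms, folded shift_def]

lemma shift_monomial:
  assumes "fst ` set w \<subseteq> {1..k}" "k \<le> 2 ^ n"
  shows "shift n (monomial a w) = monomial a (shift_word n w)"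
proof -
  have "map (map_prod (block_swap (Suc n)) id) w = shift_word n w"
    unfolding shift_word_def
    using assms by (intro map_cong) (force intro: prod_eqI simp: block_swap_le)+
  moreover have "fst ` set w \<subseteq> {1..}" using assms by auto
  ultimately show ?thesis
    unfolding shift_def by (simp add: car_action_monomial block_swap_in_finite_perms)
qed

text \<open>The permutation exchanging two blocks of length \<open>k\<close> beyond the first \<open>k\<close> indices
  moves one shifted copy of \<open>w\<close> to the other and fixes \<open>u\<close> and \<open>v\<close>.\<close>

lemma state_shift_eventually_constant:
  assumes u: "fst ` set u \<subseteq> {1..k}" and v: "fst ` set v \<subseteq> {1..k}" and w: "fst ` set w \<subseteq> {1..k}"
    and "k \<le> m" "m \<le> n"
  shows "\<phi> (monomial a u * shift n (monomial a w) * monomial a v) =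
    \<phi> (monomial a u * shift m (monomial a w) * monomial a v)"
proof (cases "m = n")
  case False
  \<comment> \<open>Since \<open>k \<le> 2 ^ m\<close>, this makes the block after
    \<open>2 ^ m\<close> end no later than \<open>2 ^ n\<close>, so the two blocks of length k are
    disjoint.\<close>
  then have mn: "(2::nat) ^ Suc m \<le> 2 ^ n" using assms by (intro power_increasing) auto
  have k: "k \<le> 2 ^ m" "k \<le> 2 ^ n" using assms by (auto intro: nat_le_two_power)
  define h where "h = swap_blocks (2 ^ m) (2 ^ n) k"
  have h: "h \<in> finite_perms"
    unfolding h_def using mn k by (intro swap_blocks_in_finite_perms) simp
  have fix_word: "map (map_prod h id) x = x" if "fst ` set x \<subseteq> {1..k}" for x :: "(nat \<times> bool) list"
  proof (rule map_idI)
    fix p assume "p \<in> set x"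
    then have "fst p \<le> k" using that by auto
    then show "map_prod h id p = p"
      using k by (auto simp: h_def swap_blocks_def intro!: prod_eqI)
  qed
  have move: "map (map_prod h id) (shift_word m w) = shift_word n w"
    unfolding shift_word_def map_map
  proof (rule map_cong[OF refl])
    fix p assume "p \<in> set w"
    then have "1 \<le> fst p" "fst p \<le> k" using w by auto
    then show "(map_prod h id \<circ> map_prod ((+) (2 ^ m)) id) p = map_prod ((+) (2 ^ n)) id p"
      by (auto simp: h_def swap_blocks_def intro!: prod_eqI)
  qed
  have "fst ` set (u @ shift_word m w @ v) \<subseteq> {1..}"
    using u v set_shift_word[OF w, of m] by auto
  then have "car_action a h (monomial a (u @ shift_word m w @ v)) = monomial a (u @ shift_word n w @ v)"
    by (simp add: car_action_monomial[OF h] fix_word[OF u] fix_word[OF v] move)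
  then have "\<phi> (monomial a (u @ shift_word n w @ v)) = \<phi> (monomial a (u @ shift_word m w @ v))"
    using state_invariant[OF h] by metis
  then show ?thesis
    by (simp add: shift_monomial[OF w k(1)] shift_monomial[OF w k(2)] monomial_append mult.assoc)
qed simp

text \<open>Adding the nonnegative term for \<open>S * adj S\<close> to that for
  \<open>adj S * S\<close> turns the squared norm into an anticommutator, whose off-diagonal terms
  vanish. The bound therefore has one term per summand, not one per pair of summands.\<close>

lemma anticommuting_sum_bound:
  assumes I: "finite I"
    and anti: "\<And>m n. m \<in> I \<Longrightarrow> n \<in> I \<Longrightarrow> m \<noteq> n \<Longrightarrow> adj (X m) * X n + X n * adj (X m) = 0"
  shows "(norm (\<pi> (\<Sum>n\<in>I. X n) x))\<^sup>2 \<le> (\<Sum>n\<in>I. (norm (\<pi> (X n) x))\<^sup>2 + (norm (\<pi> (adj (X n)) x))\<^sup>2)"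
proof -
  define q where "q = (\<lambda>A. Re (cinner (\<pi> A x) x))"
  have q_add: "q (A + B) = q A + q B" for A B by (simp add: q_def rep_add cinner_add_left)
  have q_sum: "q (\<Sum>n\<in>I. A n) = (\<Sum>n\<in>I. q (A n))" for A
    by (induction I rule: infinite_finite_induct) (simp_all add: q_add, simp_all add: q_def rep_zero)
  have q_norm: "q (adj A * A + A * adj A) = (norm (\<pi> A x))\<^sup>2 + (norm (\<pi> (adj A) x))\<^sup>2" for A
  proof -
    have "q (adj A * A) = (norm (\<pi> A x))\<^sup>2" for A
      unfolding q_def rep_mult rep_adj[of "adj A"] by (simp add: adj_adj cinner_self)
    from this[of A] this[of "adj A"] show ?thesis by (simp add: q_add adj_adj)
  qed
  let ?S = "\<Sum>n\<in>I. X n"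
  have adj_sum: "adj ?S = (\<Sum>n\<in>I. adj (X n))"
    by (rule linear_sum[OF bounded_linear.linear[OF bounded_linear_adj]])
  have "adj ?S * ?S + ?S * adj ?S = (\<Sum>m\<in>I. \<Sum>n\<in>I. adj (X m) * X n) + (\<Sum>n\<in>I. \<Sum>m\<in>I. X n * adj (X m))"
    unfolding adj_sum sum_product ..
  also have "(\<Sum>n\<in>I. \<Sum>m\<in>I. X n * adj (X m)) = (\<Sum>m\<in>I. \<Sum>n\<in>I. X n * adj (X m))"
    by (rule sum.swap)
  finally have "adj ?S * ?S + ?S * adj ?S = (\<Sum>m\<in>I. \<Sum>n\<in>I. adj (X m) * X n + X n * adj (X m))"
    by (simp add: sum.distrib)
  also have "\<dots> = (\<Sum>m\<in>I. \<Sum>n\<in>I. if n = m then adj (X m) * X m + X m * adj (X m) else 0)"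
    by (intro sum.cong refl) (auto simp: anti)
  also have "\<dots> = (\<Sum>m\<in>I. adj (X m) * X m + X m * adj (X m))"
    using I by simp
  finally have "q (adj ?S * ?S + ?S * adj ?S) = (\<Sum>m\<in>I. q (adj (X m) * X m + X m * adj (X m)))"
    by (simp only: q_sum)
  then show ?thesis unfolding q_norm by (smt (verit) zero_le_power2)
qed

text \<open>The shifted copies of an odd monomial anticommute, so their averages tend to zero
  in norm, whereas the matrix coefficients are eventually constant.\<close>

lemma odd_monomial_limit:
  assumes u: "fst ` set u \<subseteq> {1..}" and v: "fst ` set v \<subseteq> {1..}" and w: "fst ` set w \<subseteq> {1..}"
    and odd: "odd (length w)"
  shows "(\<lambda>n. \<phi> (monomial a u * shift n (monomial a w) * monomial a v)) \<longlonglongrightarrow> 0"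
proof -
  obtain ku kv kw where "fst ` set u \<subseteq> {1..ku}" "fst ` set v \<subseteq> {1..kv}" "fst ` set w \<subseteq> {1..kw}"
    using ex_word_bound u v w by metis
  then obtain k where u: "fst ` set u \<subseteq> {1..k}" and v: "fst ` set v \<subseteq> {1..k}"
    and w: "fst ` set w \<subseteq> {1..k}"
    by (metis max.cobounded1 max.cobounded2 word_bound_mono)
  define X where "X n = shift n (monomial a w)" for n
  define L where "L = \<phi> (monomial a u * X k * monomial a v)"
  have const: "\<phi> (monomial a u * X n * monomial a v) = L" if "k \<le> n" for n
    unfolding L_def X_def using state_shift_eventually_constant[OF u v w order_refl that] .
  have anti: "adj (X m) * X n + X n * adj (X m) = 0" if "k \<le> m" "k \<le> n" "m \<noteq> n" for m n
  proof -
    have wa: "fst ` set (adj_word w) \<subseteq> {1..k}" using w by simp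
    have X: "adj (X m) = monomial a (shift_word m (adj_word w))" "X n = monomial a (shift_word n w)"
      unfolding X_def shift_adj[symmetric] adj_monomial
      by (rule shift_monomial[OF wa] shift_monomial[OF w], use that in \<open>auto intro: nat_le_two_power\<close>)+
    \<comment> \<open>Both exponents are at least k, so each block ends no later than the next power
      of two, beyond which every later block lies.\<close>
    have "{2 ^ m + 1..2 ^ m + k} \<inter> {2 ^ n + 1..2 ^ n + k} = ({}::nat set)"
    proof -
      have "2 ^ i + k \<le> (2::nat) ^ j" if "i < j" "k \<le> i" for i j
      proof -
        have "k \<le> 2 ^ i" using that by (intro nat_le_two_power)
        moreover have "(2::nat) ^ Suc i \<le> 2 ^ j" using that by (intro power_increasing) auto
        ultimately show ?thesis by simp
      qed
      from this[of m n] this[of n m] show ?thesis using that by (cases "m < n") auto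
    qed
    then have "fst ` set (shift_word m (adj_word w)) \<inter> fst ` set (shift_word n w) = {}"
      using set_shift_word[OF wa, of m] set_shift_word[OF w, of n] by blast
    moreover have "fst ` set (shift_word m (adj_word w)) \<subseteq> {1..}" "fst ` set (shift_word n w) \<subseteq> {1..}"
      using set_shift_word[OF wa, of m] set_shift_word[OF w, of n] by auto
    \<comment> \<open>The square of an odd length is odd, so this sign is -1.\<close>
    ultimately have "adj (X m) * X n = (-1) ^ (length w * length w) * (X n * adj (X m))"
      unfolding X using monomial_commute_disjoint by fastforce
    then show ?thesis using odd by simp
  qed
  define x where "x = \<pi> (monomial a v) \<Omega>"
  define y where "y = \<pi> (adj (monomial a u)) \<Omega>"
  define c where "c = (onorm (\<pi> (monomial a w)) * norm x)\<^sup>2 + (onorm (\<pi> (adj (monomial a w))) * norm x)\<^sup>2"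
  have X_le: "(norm (\<pi> (X n) x))\<^sup>2 + (norm (\<pi> (adj (X n)) x))\<^sup>2 \<le> c" for n
    unfolding c_def X_def shift_adj[symmetric]
    by (intro add_mono power_mono norm_rep_shift_le norm_ge_zero)
  \<comment> \<open>The sum of M copies has matrix coefficient \<open>M * L\<close>, while its
    squared norm at x is at most \<open>M * c\<close>. Cauchy-Schwarz and division by M leave a
    bound on \<open>M * (cmod L)\<^sup>2\<close> independent of M, which forces L to vanish.\<close>
  have "real M * (cmod L)\<^sup>2 \<le> c * (norm y)\<^sup>2" if "M > 0" for M
  proof -
    let ?I = "{k..<k + M}"
    let ?S = "\<Sum>n\<in>?I. X n"
    have "cinner (\<pi> ?S x) y = \<phi> (\<Sum>n\<in>?I. monomial a u * X n * monomial a v)"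
      unfolding x_def y_def matrix_coefficient by (simp add: adj_adj sum_distrib_left sum_distrib_right)
    also have "\<dots> = (\<Sum>n\<in>?I. L)" unfolding blinfun.sum_right by (intro sum.cong) (auto simp: const)
    finally have "cinner (\<pi> ?S x) y = of_nat M * L" by simp
    then have "real M * cmod L \<le> norm (\<pi> ?S x) * norm y"
      using cinner_Cauchy_Schwarz[of "\<pi> ?S x" y] by (simp add: norm_mult)
    then have "(real M * cmod L)\<^sup>2 \<le> (norm (\<pi> ?S x) * norm y)\<^sup>2" by (intro power_mono) auto
    also have "\<dots> \<le> (real M * c) * (norm y)\<^sup>2"
    proof -
      have "(norm (\<pi> ?S x))\<^sup>2 \<le> (\<Sum>n\<in>?I. (norm (\<pi> (X n) x))\<^sup>2 + (norm (\<pi> (adj (X n)) x))\<^sup>2)"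
        by (rule anticommuting_sum_bound) (auto intro: anti)
      also have "\<dots> \<le> (\<Sum>n\<in>?I. c)" by (intro sum_mono X_le)
      finally show ?thesis by (simp add: power_mult_distrib mult_right_mono)
    qed
    finally have "real M * (real M * (cmod L)\<^sup>2) \<le> real M * (c * (norm y)\<^sup>2)"
      by (simp add: power2_eq_square mult_ac)
    then show ?thesis using that by (simp add: mult_le_cancel_left)
  qed
  then have "(cmod L)\<^sup>2 = 0"
    by (intro real_archimedian_rdiv_eq_0[of _ "c * (norm y)\<^sup>2"]) (auto simp: c_def)
  then have "L = 0" by simp
  then show ?thesis
    using const unfolding X_def by (intro tendsto_eventually eventually_sequentiallyI[of k]) simp
qed

text \<open>Once the shifted word has moved beyond the indices of a word v, the two monomials
  commute exactly, the sign exponent being even. The commutator norm is a seminorm in x, bounded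
  uniformly in n because shifts are isometric.\<close>

lemma even_monomial_asymptotically_commutes:
  assumes w: "fst ` set w \<subseteq> {1..}" and even: "even (length w)"
  shows "(\<lambda>n. norm (x * shift n (monomial a w) - shift n (monomial a w) * x)) \<longlonglongrightarrow> 0"
proof (rule seminorms_tendsto_zero[where
      p="\<lambda>n x. norm (x * shift n (monomial a w) - shift n (monomial a w) * x)"
      and K="2 * norm (monomial a w)"])
  fix n x y and c :: complex
  let ?X = "shift n (monomial a w)"
  show "norm ((x + y) * ?X - ?X * (x + y)) \<le> norm (x * ?X - ?X * x) + norm (y * ?X - ?X * y)"
    using norm_triangle_ineq[of "x * ?X - ?X * x" "y * ?X - ?X * y"] by (simp add: algebra_simps)
  show "norm (c *\<^sub>C x * ?X - ?X * c *\<^sub>C x) \<le> cmod c * norm (x * ?X - ?X * x)"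
    by (simp add: mult_scaleC_left mult_scaleC_right scaleC_diff_right[symmetric] norm_scaleC)
  show "norm (x * ?X - ?X * x) \<le> 2 * norm (monomial a w) * norm x"
    using norm_triangle_ineq4[of "x * ?X" "?X * x"] norm_mult_ineq[of x ?X] norm_mult_ineq[of ?X x]
    by (simp add: norm_shift mult.commute)
next
  fix v :: "(nat \<times> bool) list" assume v: "fst ` set v \<subseteq> {1..}"
  obtain kv kw where "fst ` set v \<subseteq> {1..kv}" "fst ` set w \<subseteq> {1..kw}"
    using ex_word_bound v w by metis
  then obtain k where vk: "fst ` set v \<subseteq> {1..k}" and wk: "fst ` set w \<subseteq> {1..k}"
    by (metis max.cobounded1 max.cobounded2 word_bound_mono)
  have "monomial a v * shift n (monomial a w) = shift n (monomial a w) * monomial a v" if "k \<le> n" for n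
  proof -
    have n: "k \<le> 2 ^ n" using that by (rule nat_le_two_power)
    have sub: "fst ` set (shift_word n w) \<subseteq> {2 ^ n + 1..2 ^ n + k}" using set_shift_word[OF wk] .
    then have "fst ` set v \<inter> fst ` set (shift_word n w) = {}" using vk n by fastforce
    moreover have "fst ` set (shift_word n w) \<subseteq> {1..}" using sub by fastforce
    ultimately show ?thesis
      using monomial_commute_disjoint[of v "shift_word n w"] v even by (simp add: shift_monomial[OF wk n])
  qed
  then show "(\<lambda>n. norm (monomial a v * shift n (monomial a w) - shift n (monomial a w) * monomial a v))
      \<longlonglongrightarrow> 0"
    by (intro tendsto_eventually eventually_sequentiallyI[of k]) simp
qed simp

text \<open>The value of the limit is not yet known, so the Cauchy property is proved instead:
  differences over pairs of indices vanish eventually for monomials x, and density applies along the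
  product filter.\<close>

lemma state_mult_shift_convergent:
  assumes w: "fst ` set w \<subseteq> {1..}"
  shows "convergent (\<lambda>n. \<phi> (x * shift n (monomial a w)))"
proof -
  let ?t = "\<lambda>n x. \<phi> (x * shift n (monomial a w))"
  have "((\<lambda>i. cmod (?t (fst i) x - ?t (snd i) x)) \<longlongrightarrow> 0) (sequentially \<times>\<^sub>F sequentially)"
  proof (rule seminorms_tendsto_zero[where p="\<lambda>i x. cmod (?t (fst i) x - ?t (snd i) x)"
        and K="2 * norm \<phi> * norm (monomial a w)"])
    fix i :: "nat \<times> nat" and x y and c :: complex
    show "cmod (?t (fst i) (x + y) - ?t (snd i) (x + y)) \<le>
        cmod (?t (fst i) x - ?t (snd i) x) + cmod (?t (fst i) y - ?t (snd i) y)"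
      using norm_triangle_ineq[of "?t (fst i) x - ?t (snd i) x" "?t (fst i) y - ?t (snd i) y"]
      by (simp add: algebra_simps blinfun.add_right)
    show "cmod (?t (fst i) (c *\<^sub>C x) - ?t (snd i) (c *\<^sub>C x)) \<le> cmod c * cmod (?t (fst i) x - ?t (snd i) x)"
      by (simp add: mult_scaleC_left state_scaleC right_diff_distrib[symmetric] norm_mult)
    have "cmod (?t n x) \<le> norm \<phi> * norm (monomial a w) * norm x" for n
    proof -
      have "cmod (?t n x) \<le> norm \<phi> * norm (x * shift n (monomial a w))" by (rule norm_blinfun)
      also have "\<dots> \<le> norm \<phi> * (norm x * norm (monomial a w))"
        using norm_mult_ineq[of x "shift n (monomial a w)"] by (intro mult_left_mono) (simp_all add: norm_shift)
      finally show ?thesis by (simp add: mult_ac)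
    qed
    from this[of "fst i"] this[of "snd i"]
    show "cmod (?t (fst i) x - ?t (snd i) x) \<le> 2 * norm \<phi> * norm (monomial a w) * norm x"
      using norm_triangle_ineq4[of "?t (fst i) x" "?t (snd i) x"] by simp
  next
    fix v :: "(nat \<times> bool) list" assume v: "fst ` set v \<subseteq> {1..}"
    obtain kv kw where "fst ` set v \<subseteq> {1..kv}" "fst ` set w \<subseteq> {1..kw}"
      using ex_word_bound v w by metis
    then obtain k where vk: "fst ` set v \<subseteq> {1..k}" and wk: "fst ` set w \<subseteq> {1..k}"
      by (metis max.cobounded1 max.cobounded2 word_bound_mono)
    have "?t n (monomial a v) = ?t k (monomial a v)" if "k \<le> n" for n
      using state_shift_eventually_constant[OF vk _ wk order_refl that, of "[]"] by simp
    then have eq: "?t n (monomial a v) = ?t m (monomial a v)" if "k \<le> n" "k \<le> m" for m n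
      using that by metis
    have "\<forall>\<^sub>F i in sequentially \<times>\<^sub>F sequentially.
        cmod (?t (fst i) (monomial a v) - ?t (snd i) (monomial a v)) = 0"
      unfolding eventually_prod_sequentially
    proof (intro exI[of _ k] allI impI)
      show "cmod (?t (fst (n, m)) (monomial a v) - ?t (snd (n, m)) (monomial a v)) = 0"
        if "k \<le> m" "k \<le> n" for m n
        using eq[OF that(2,1)] by simp
    qed
    then show "((\<lambda>i. cmod (?t (fst i) (monomial a v) - ?t (snd i) (monomial a v))) \<longlongrightarrow> 0)
        (sequentially \<times>\<^sub>F sequentially)"
      by (rule tendsto_eventually)
  qed simp
  note lim = this
  have "Cauchy (\<lambda>n. ?t n x)"
  proof (rule metric_CauchyI)
    fix e :: real assume "e > 0"
    from order_tendstoD(2)[OF lim this] obtain N where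
      "\<forall>m\<ge>N. \<forall>n\<ge>N. cmod (?t n x - ?t m x) < e"
      unfolding eventually_prod_sequentially by auto
    then show "\<exists>N. \<forall>m\<ge>N. \<forall>n\<ge>N. dist (?t m x) (?t n x) < e" unfolding dist_norm by blast
  qed
  then show ?thesis by (rule Cauchy_convergent)
qed

text \<open>For large n the shifted word lies beyond the support of g and is fixed by it, so the
  action can be applied to the whole product and absorbed by \<phi>.\<close>

lemma shift_limit_invariant:
  assumes w: "fst ` set w \<subseteq> {1..}" and g: "g \<in> finite_perms"
  shows "(\<lambda>n. cmod (\<phi> (car_action a g x * shift n (monomial a w)) - \<phi> (x * shift n (monomial a w)))) \<longlonglongrightarrow> 0"
proof -
  obtain kw where kw: "fst ` set w \<subseteq> {1..kw}" using ex_word_bound w by metis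
  have "finite {k. g k \<noteq> k}" using g by (simp add: finite_perms_def)
  then obtain kg where kg: "\<forall>k\<in>{k. g k \<noteq> k}. k \<le> kg"
    using finite_nat_set_iff_bounded_le by meson
  define k where "k = max kw kg"
  have wk: "fst ` set w \<subseteq> {1..k}" using kw by (rule word_bound_mono) (simp add: k_def)
  have "car_action a g (shift n (monomial a w)) = shift n (monomial a w)" if "k \<le> n" for n
  proof -
    have n: "k \<le> 2 ^ n" using that by (rule nat_le_two_power)
    have sub: "fst ` set (shift_word n w) \<subseteq> {2 ^ n + 1..2 ^ n + k}" using set_shift_word[OF wk] .
    have "map (map_prod g id) (shift_word n w) = shift_word n w"
    proof (rule map_idI)
      fix p assume "p \<in> set (shift_word n w)"
      then have "2 ^ n + 1 \<le> fst p" using sub by fastforce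
      then have "\<not> fst p \<le> kg" using n by (simp add: k_def)
      then show "map_prod g id p = p" using kg by (auto intro!: prod_eqI)
    qed
    moreover have "fst ` set (shift_word n w) \<subseteq> {1..}" using sub by fastforce
    ultimately show ?thesis by (simp add: shift_monomial[OF wk n] car_action_monomial[OF g])
  qed
  then have "\<phi> (car_action a g x * shift n (monomial a w)) = \<phi> (x * shift n (monomial a w))" if "k \<le> n" for n
    using that car_action_mult[OF g] state_invariant[OF g] by metis
  then show ?thesis by (intro tendsto_eventually eventually_sequentiallyI[of k]) simp
qed

lemma even_monomial_limit:
  assumes w: "fst ` set w \<subseteq> {1..}" and even: "even (length w)"
  shows "(\<lambda>n. \<phi> (x * shift n (monomial a w) * y)) \<longlonglongrightarrow> \<phi> (monomial a w) * \<phi> (x * y)"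
proof -
  define W where "W = monomial a w"
  define f where "f x = lim (\<lambda>n. \<phi> (x * shift n W))" for x
  have f: "(\<lambda>n. \<phi> (x * shift n W)) \<longlonglongrightarrow> f x" for x
    unfolding f_def W_def using state_mult_shift_convergent[OF w] by (simp add: convergent_LIMSEQ_iff)
  \<comment> \<open>Evenness of w enters here: y is moved past the shifted monomial at a cost
    tending to zero.\<close>
  have swap: "(\<lambda>n. \<phi> (x * shift n W * y)) \<longlonglongrightarrow> f (x * y)" for x y
  proof -
    have "(\<lambda>n. \<phi> (x * y * shift n W) - \<phi> (x * shift n W * y)) \<longlonglongrightarrow> 0"
    proof (rule Lim_null_comparison)
      show "(\<lambda>n. norm \<phi> * norm x * norm (y * shift n W - shift n W * y)) \<longlonglongrightarrow> 0"
        unfolding W_def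
        by (rule tendsto_mult_right_zero[OF even_monomial_asymptotically_commutes[OF w even]])
      have "cmod (\<phi> (x * y * shift n W) - \<phi> (x * shift n W * y))
          \<le> norm \<phi> * norm x * norm (y * shift n W - shift n W * y)" for n
      proof -
        have "\<phi> (x * y * shift n W) - \<phi> (x * shift n W * y) = \<phi> (x * (y * shift n W - shift n W * y))"
          by (simp add: blinfun.diff_right[symmetric] right_diff_distrib mult.assoc)
        also have "cmod \<dots> \<le> norm \<phi> * norm (x * (y * shift n W - shift n W * y))" by (rule norm_blinfun)
        also have "\<dots> \<le> norm \<phi> * (norm x * norm (y * shift n W - shift n W * y))"
          by (intro mult_left_mono norm_mult_ineq norm_ge_zero)
        finally show ?thesis by (simp only: mult.assoc)
      qed
      then show "\<forall>\<^sub>F n in sequentially. cmod (\<phi> (x * y * shift n W) - \<phi> (x * shift n W * y))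
          \<le> norm \<phi> * norm x * norm (y * shift n W - shift n W * y)" by simp
    qed
    from tendsto_diff[OF f[of "x * y"] this] show ?thesis by simp
  qed
  have f_add: "f (x + y) = f x + f y" for x y
    using tendsto_add[OF f[of x] f[of y]] f[of "x + y"] LIMSEQ_unique
    by (simp add: distrib_right blinfun.add_right)
  have f_scale: "f (c *\<^sub>C x) = c * f x" for c x
    using tendsto_mult_left[OF f[of x], of c] f[of "c *\<^sub>C x"] LIMSEQ_unique
    by (simp add: mult_scaleC_left state_scaleC)
  have f_bound: "cmod (f x) \<le> norm x * (norm \<phi> * norm W)" for x
  proof (rule cmod_limit_le[OF f])
    fix n
    have "cmod (\<phi> (x * shift n W)) \<le> norm \<phi> * norm (x * shift n W)" by (rule norm_blinfun)
    also have "\<dots> \<le> norm \<phi> * (norm x * norm W)"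
      using norm_mult_ineq[of x "shift n W"] by (intro mult_left_mono) (simp_all add: norm_shift)
    finally show "cmod (\<phi> (x * shift n W)) \<le> norm x * (norm \<phi> * norm W)" by (simp add: mult_ac)
  qed
  have "bounded_linear f"
  proof (rule bounded_linear_intro[OF f_add _ f_bound])
    show "f (r *\<^sub>R x) = r *\<^sub>R f x" for r x
      unfolding scaleC_of_real[symmetric] by (simp add: f_scale scaleR_conv_of_real)
  qed
  moreover have "f (car_action a g x) = f x" if "g \<in> finite_perms" for g x
  proof -
    have "(\<lambda>n. \<phi> (car_action a g x * shift n W) - \<phi> (x * shift n W)) \<longlonglongrightarrow> 0"
      unfolding W_def using shift_limit_invariant[OF w that] by (rule tendsto_norm_zero_cancel)
    with tendsto_diff[OF f f] LIMSEQ_unique show ?thesis by fastforce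
  qed
  ultimately have "invariant_functional f"
    unfolding invariant_functional_def using f_scale by blast
  \<comment> \<open>With the shifted factor moved to the middle, \<open>f (adj x * x)\<close> is a
    limit of matrix coefficients at the vector \<open>\<pi> x \<Omega>\<close>, to which the uniform
    operator norm bound applies.\<close>
  moreover have "cmod (f (adj x * x)) \<le> onorm (\<pi> W) * Re (\<phi> (adj x * x))" for x
  proof (rule cmod_limit_le[OF swap])
    fix n
    have "cmod (\<phi> (adj x * shift n W * x)) \<le> norm (\<pi> (shift n W) (\<pi> x \<Omega>)) * norm (\<pi> x \<Omega>)"
      unfolding matrix_coefficient[symmetric] by (rule cinner_Cauchy_Schwarz)
    also have "\<dots> \<le> onorm (\<pi> W) * norm (\<pi> x \<Omega>) * norm (\<pi> x \<Omega>)"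
      by (intro mult_right_mono norm_rep_shift_le norm_ge_zero)
    finally show "cmod (\<phi> (adj x * shift n W * x)) \<le> onorm (\<pi> W) * Re (\<phi> (adj x * x))"
      by (simp add: norm_rep_cyclic[symmetric] power2_eq_square mult.assoc)
  qed
  ultimately have "f x = f 1 * \<phi> x" for x
    by (rule invariant_functional_eq_multiple)
  moreover have "f 1 = \<phi> W"
    using f[of 1] by (simp add: state_shift LIMSEQ_const_iff)
  ultimately show ?thesis using swap[of x y] unfolding W_def by simp
qed

text \<open>The defect q is linear in each of its three arguments and bounded uniformly in n, so the
  monomial case extends by density in one argument at a time: z, y and x in that order.\<close>

lemma state_shift_limit:
  "(\<lambda>n. \<phi> (x * shift n y * z)) \<longlonglongrightarrow> \<phi> y * \<phi> (x * z)"
proof -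
  define q where "q n x y z = \<phi> (x * shift n y * z) - \<phi> y * \<phi> (x * z)" for n x y z
  have q_mult: "\<phi> (x * shift n y * z) = q n x y z + \<phi> y * \<phi> (x * z)" for n x y z
    by (simp add: q_def)
  have q_add: "q n (x + x') y z = q n x y z + q n x' y z" "q n x (y + y') z = q n x y z + q n x y' z"
    "q n x y (z + z') = q n x y z + q n x y z'" for n x x' y y' z z'
    by (simp_all add: q_def blinfun.add_right shift_add algebra_simps)
  have q_scale: "q n (c *\<^sub>C x) y z = c * q n x y z" "q n x (c *\<^sub>C y) z = c * q n x y z"
    "q n x y (c *\<^sub>C z) = c * q n x y z" for n x y z c
    by (simp_all add: q_def state_scaleC shift_scaleC mult_scaleC_left mult_scaleC_right algebra_simps)
  define K where "K = norm \<phi> + norm \<phi> * norm \<phi>"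
  have q_bound: "cmod (q n x y z) \<le> K * norm x * norm y * norm z" for n x y z
  proof -
    have "norm (x * shift n y * z) \<le> norm x * norm y * norm z"
      using norm_mult_ineq[of "x * shift n y" z]
        mult_right_mono[OF norm_mult_ineq[of x "shift n y"] norm_ge_zero[of z]]
      by (simp add: norm_shift)
    then have "cmod (\<phi> (x * shift n y * z)) \<le> norm \<phi> * (norm x * norm y * norm z)"
      using norm_blinfun[of \<phi> "x * shift n y * z"] mult_left_mono[OF _ norm_ge_zero[of \<phi>]]
        order_trans by blast
    moreover have "cmod (\<phi> y) * cmod (\<phi> (x * z)) \<le> (norm \<phi> * norm y) * (norm \<phi> * (norm x * norm z))"
      using norm_blinfun[of \<phi> "x * z"] norm_mult_ineq[of x z]
      by (intro mult_mono norm_blinfun order_trans[OF norm_blinfun] mult_left_mono) auto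
    ultimately show ?thesis
      using norm_triangle_ineq4[of "\<phi> (x * shift n y * z)" "\<phi> y * \<phi> (x * z)"]
      by (simp add: q_def K_def norm_mult algebra_simps)
  qed
  have mmm: "(\<lambda>n. cmod (q n (monomial a u) (monomial a w) (monomial a v))) \<longlonglongrightarrow> 0"
    if u: "fst ` set u \<subseteq> {1..}" and w: "fst ` set w \<subseteq> {1..}" and v: "fst ` set v \<subseteq> {1..}" for u w v
  proof (cases "even (length w)")
    case True
    then have "(\<lambda>n. q n (monomial a u) (monomial a w) (monomial a v)) \<longlonglongrightarrow> 0"
      unfolding q_def by (intro LIM_zero even_monomial_limit[OF w])
    then show ?thesis by (rule tendsto_norm_zero)
  next
    case False
    \<comment> \<open>With both outer words empty the sequence is constant by invariance, so its
      limit 0 is the expectation of the odd monomial itself.\<close>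
    have "\<phi> (monomial a w) = 0"
      using odd_monomial_limit[of "[]" "[]" w] w False by (simp add: state_shift LIMSEQ_const_iff)
    then have "(\<lambda>n. q n (monomial a u) (monomial a w) (monomial a v)) \<longlonglongrightarrow> 0"
      unfolding q_def using odd_monomial_limit[OF u v w False] by simp
    then show ?thesis by (rule tendsto_norm_zero)
  qed
  have mm: "(\<lambda>n. cmod (q n (monomial a u) (monomial a w) z)) \<longlonglongrightarrow> 0"
    if "fst ` set u \<subseteq> {1..}" "fst ` set w \<subseteq> {1..}" for u w z
  proof (rule seminorms_tendsto_zero[where p="\<lambda>n z. cmod (q n (monomial a u) (monomial a w) z)"])
    show "cmod (q n (monomial a u) (monomial a w) z) \<le> K * norm (monomial a u) * norm (monomial a w) * norm z"
      for n z by (rule q_bound)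
  qed (simp_all add: q_add q_scale norm_mult norm_triangle_ineq mmm[OF that, simplified])
  have m: "(\<lambda>n. cmod (q n (monomial a u) y z)) \<longlonglongrightarrow> 0"
    if "fst ` set u \<subseteq> {1..}" for u y z
  proof (rule seminorms_tendsto_zero[where p="\<lambda>n y. cmod (q n (monomial a u) y z)"])
    show "cmod (q n (monomial a u) y z) \<le> K * norm (monomial a u) * norm z * norm y" for n y
      using q_bound[of n "monomial a u" y z] by (simp only: mult_ac)
  qed (simp_all add: q_add q_scale norm_mult norm_triangle_ineq mm[OF that, simplified])
  have "(\<lambda>n. cmod (q n x y z)) \<longlonglongrightarrow> 0"
  proof (rule seminorms_tendsto_zero[where p="\<lambda>n x. cmod (q n x y z)"])
    show "cmod (q n x y z) \<le> K * norm y * norm z * norm x" for n x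
      using q_bound[of n x y z] by (simp only: mult_ac)
  qed (simp_all add: q_add q_scale norm_mult norm_triangle_ineq m[simplified])
  then have "(\<lambda>n. q n x y z) \<longlonglongrightarrow> 0" by (rule tendsto_norm_zero_cancel)
  then show ?thesis unfolding q_def by (rule LIM_zero_cancel)
qed

text \<open>On cyclic vectors this is the factorization of \<phi>; the uniform operator norm bound
  extends it to arbitrary vectors, in y and in x separately.\<close>

lemma matrix_coefficient_limit:
  "(\<lambda>n. cinner (\<pi> (shift n A) x) y) \<longlonglongrightarrow> \<phi> A * cinner x y"
proof -
  define d where "d n x y = cinner (\<pi> (shift n A) x) y - \<phi> A * cinner x y" for n x y
  have d_diff: "d n x y - d n x' y = d n (x - x') y" "d n x y - d n x y' = d n x (y - y')" for n x x' y y'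
    by (simp_all add: d_def cinner_diff_left cinner_diff_right right_diff_distrib
        linear_diff[OF bounded_linear.linear[OF rep_bounded_linear]])
  have d_bound: "cmod (d n x y) \<le> (onorm (\<pi> A) + cmod (\<phi> A)) * norm x * norm y" for n x y
  proof -
    have "cmod (cinner (\<pi> (shift n A) x) y) \<le> onorm (\<pi> A) * norm x * norm y"
      using cinner_Cauchy_Schwarz mult_right_mono[OF norm_rep_shift_le norm_ge_zero] order_trans by blast
    moreover have "cmod (\<phi> A) * cmod (cinner x y) \<le> cmod (\<phi> A) * (norm x * norm y)"
      by (intro mult_left_mono cinner_Cauchy_Schwarz norm_ge_zero)
    ultimately show ?thesis
      using norm_triangle_ineq4[of "cinner (\<pi> (shift n A) x) y" "\<phi> A * cinner x y"]
      by (simp add: d_def norm_mult algebra_simps)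
  qed
  have cyc: "(\<lambda>n. d n (\<pi> B \<Omega>) (\<pi> C \<Omega>)) \<longlonglongrightarrow> 0" for B C
  proof -
    have "cinner (\<pi> B \<Omega>) (\<pi> C \<Omega>) = \<phi> (adj C * B)"
      using matrix_coefficient[of 1 B C] by (simp add: rep_one)
    then show ?thesis
      unfolding d_def matrix_coefficient
      by (simp add: LIM_zero[OF state_shift_limit[of "adj C" A B]])
  qed
  have right: "(\<lambda>n. d n (\<pi> B \<Omega>) y) \<longlonglongrightarrow> 0" for B y
  proof (rule tendsto_zero_of_dense[where d="\<lambda>n. d n (\<pi> B \<Omega>)", OF _ cyclic])
    show "cmod (d n (\<pi> B \<Omega>) y - d n (\<pi> B \<Omega>) y')
        \<le> (onorm (\<pi> A) + cmod (\<phi> A)) * norm (\<pi> B \<Omega>) * norm (y - y')" for n y y'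
      unfolding d_diff by (rule d_bound)
  qed (auto simp: cyc)
  have "(\<lambda>n. d n x y) \<longlonglongrightarrow> 0"
  proof (rule tendsto_zero_of_dense[where d="\<lambda>n x. d n x y", OF _ cyclic])
    show "cmod (d n x y - d n x' y) \<le> (onorm (\<pi> A) + cmod (\<phi> A)) * norm y * norm (x - x')" for n x x'
      using d_bound[of n "x - x'" y] by (simp add: d_diff mult_ac)
  qed (auto simp: right)
  then show ?thesis unfolding d_def by (rule LIM_zero_cancel)
qed

end

section \<open>The weak limit and the conditional expectation\<close>

text \<open>Convergence is checked on the subbasis and passes through finite intersections and
  unions by induction on the generation of open sets.\<close>

lemma limitin_weak_operator_topologyI:
  assumes l: "l \<in> bounded_ops"
    and ops: "\<forall>\<^sub>F i in F. f i \<in> bounded_ops"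
    and lim: "\<And>x y. ((\<lambda>i. cinner (f i x) y) \<longlongrightarrow> cinner (l x) y) F"
  shows "limitin weak_operator_topology f l F"
  unfolding limitin_def
proof (intro conjI allI impI)
  let ?B = "{{T \<in> bounded_ops. cinner (T x) y \<in> V} | x y V. open V} :: ('a \<Rightarrow> 'a) set set"
  \<comment> \<open>With V the whole plane a subbasic set contains every bounded operator, whichever
    vectors are chosen, so the topology lives on all of \<open>bounded_ops\<close>.\<close>
  have "{T \<in> bounded_ops. cinner (T undefined) undefined \<in> UNIV} \<in> ?B" by blast
  then show "l \<in> topspace weak_operator_topology"
    unfolding weak_operator_topology_def topology_generated_by_topspace using l by blast
  fix W assume W: "openin weak_operator_topology W \<and> l \<in> W"
  then have "generate_topology_on ?B W"
    unfolding weak_operator_topology_def by (simp add: openin_topology_generated_by_iff)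
  then have "l \<in> W \<longrightarrow> (\<forall>\<^sub>F i in F. f i \<in> W)"
  proof induction
    case (Int a b)
    then show ?case by (auto elim: eventually_elim2)
  next
    case (UN \<K>)
    show ?case
    proof
      assume "l \<in> \<Union>\<K>"
      then obtain k where "k \<in> \<K>" "\<forall>\<^sub>F i in F. f i \<in> k" using UN by blast
      then show "\<forall>\<^sub>F i in F. f i \<in> \<Union>\<K>" by (auto elim: eventually_mono)
    qed
  next
    case (Basis s)
    then obtain x y V where s: "s = {T \<in> bounded_ops. cinner (T x) y \<in> V}" and V: "open V" by blast
    show ?case
    proof
      assume "l \<in> s"
      then have "\<forall>\<^sub>F i in F. cinner (f i x) y \<in> V" using topological_tendstoD[OF lim V] s by blast
      with ops show "\<forall>\<^sub>F i in F. f i \<in> s" by eventually_elim (simp add: s)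
    qed
  qed simp
  with W show "\<forall>\<^sub>F i in F. f i \<in> W" by blast
qed

section \<open>Scalars and algebraic operations in commutants\<close>

lemma scaleC_in_bounded_ops: "(\<lambda>x. c *\<^sub>C x) \<in> bounded_ops"
  unfolding bounded_ops_def by (simp add: bounded_linear_scaleC_right scaleC_scaleC mult.commute)

lemma scaleC_in_commutant: "S \<subseteq> bounded_ops \<Longrightarrow> (\<lambda>x. c *\<^sub>C x) \<in> commutant S"
  unfolding commutant_def using scaleC_in_bounded_ops by (auto simp: bounded_ops_def fun_eq_iff)

lemma commutant_subset_bounded_ops: "commutant S \<subseteq> bounded_ops"
  unfolding commutant_def by blast

lemma commutant_add:
  assumes "S \<subseteq> bounded_ops" "X \<in> commutant S" "Y \<in> commutant S"
  shows "(\<lambda>x. X x + Y x) \<in> commutant S"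
  using assms unfolding commutant_def bounded_ops_def
  by (auto simp: fun_eq_iff bounded_linear_add scaleC_add_right linear_add[OF bounded_linear.linear] subset_iff)

lemma commutant_scaleC:
  assumes "S \<subseteq> bounded_ops" "X \<in> commutant S"
  shows "(\<lambda>x. c *\<^sub>C X x) \<in> commutant S"
  using assms bounded_linear_compose[OF bounded_linear_scaleC_right] unfolding commutant_def bounded_ops_def
  by (auto simp: fun_eq_iff scaleC_scaleC mult.commute subset_iff)

lemma commutant_comp:
  assumes "X \<in> commutant S" "Y \<in> commutant S"
  shows "X \<circ> Y \<in> commutant S"
  using assms bounded_linear_compose unfolding commutant_def bounded_ops_def
  by (auto simp: fun_eq_iff o_def)

context gns_extreme_state
begin

lemma rep_in_vn_algebra: "\<pi> A \<in> gns_vn_algebra \<pi>"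
  unfolding gns_vn_algebra_def commutant_def using rep_bounded_op by auto

text \<open>The functional \<open>A \<mapsto> <\<pi> A Z \<Omega>, \<Omega>>\<close> is symmetric,
  and dominated by \<phi> because Z commutes with the representation; hence it is c times \<phi>.
  Thus \<open>Z \<Omega> - c \<Omega>\<close> is orthogonal to the cyclic subspace, and commutation
  carries \<open>Z \<Omega> = c \<Omega>\<close> to all cyclic vectors.\<close>

lemma invariant_center_eq_scalars: "invariant_center \<pi> U = range (\<lambda>c x. c *\<^sub>C x)"
proof (intro equalityI subsetI)
  fix Z assume Z: "Z \<in> invariant_center \<pi> U"
  then have Zc: "Z \<in> commutant (range \<pi>)" and ZU: "\<And>g. g \<in> finite_perms \<Longrightarrow> U g \<circ> Z \<circ> inv (U g) = Z"
    unfolding invariant_center_def gns_center_def by auto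
  have Zb: "Z \<in> bounded_ops" using Zc commutant_subset_bounded_ops by blast
  then have Zlin: "bounded_linear Z" by (simp add: bounded_ops_def)
  have comm: "Z (\<pi> A x) = \<pi> A (Z x)" for A x
    using Zc unfolding commutant_def by (auto simp: fun_eq_iff)
  define f where "f A = cinner (\<pi> A (Z \<Omega>)) \<Omega>" for A
  have f_eq: "f A = cinner (Z (\<pi> A \<Omega>)) \<Omega>" for A by (simp add: f_def comm)
  have Z_le: "norm (Z x) \<le> onorm Z * norm x" for x by (rule onorm[OF Zlin])
  have f_add: "f (A + B) = f A + f B" for A B by (simp add: f_def rep_add cinner_add_left)
  have f_scale: "f (c *\<^sub>C A) = c * f A" for c A by (simp add: f_def rep_scaleC cinner_scaleC_left)
  have f_bound: "cmod (f A) \<le> norm A * (onorm Z * (norm \<phi> + 1))" for A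
  proof -
    have "cmod (f A) \<le> norm (Z (\<pi> A \<Omega>)) * norm \<Omega>" unfolding f_eq by (rule cinner_Cauchy_Schwarz)
    also have "\<dots> \<le> onorm Z * norm (\<pi> A \<Omega>)" using Z_le[of "\<pi> A \<Omega>"] by (simp add: norm_cyclic)
    also have "\<dots> \<le> onorm Z * ((norm \<phi> + 1) * norm A)"
      by (intro mult_left_mono norm_rep_cyclic_le onorm_pos_le Zlin)
    finally show ?thesis by (simp add: mult_ac)
  qed
  have "bounded_linear f"
  proof (rule bounded_linear_intro[OF f_add _ f_bound])
    show "f (r *\<^sub>R x) = r *\<^sub>R f x" for r x
      unfolding scaleC_of_real[symmetric] by (simp add: f_scale scaleR_conv_of_real)
  qed
  moreover have "f (car_action a g A) = f A" if g: "g \<in> finite_perms" for g A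
  proof -
    \<comment> \<open>Since Z and \<Omega> are both invariant, the vector \<open>Z \<Omega>\<close>
      is fixed by every implementing unitary.\<close>
    have "inv (U g) (Z \<Omega>) = Z \<Omega>"
    proof -
      have "Z \<Omega> = U g (Z (inv (U g) \<Omega>))" using ZU[OF g] by (metis comp_apply)
      also have "inv (U g) \<Omega> = \<Omega>" using unitary_inv[OF g, of \<Omega>] by (simp add: unitary_cyclic[OF g])
      finally show ?thesis using unitary_inv[OF g] by metis
    qed
    then have "f (car_action a g A) = cinner (U g (\<pi> A (Z \<Omega>))) (U g \<Omega>)"
      by (simp add: f_def unitary_implements[OF g] unitary_cyclic[OF g])
    then show ?thesis by (simp add: unitary_cinner[OF g] f_def)
  qed
  ultimately have "invariant_functional f"
    unfolding invariant_functional_def using f_scale by blast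
  moreover have "cmod (f (adj A * A)) \<le> onorm Z * Re (\<phi> (adj A * A))" for A
  proof -
    have "f (adj A * A) = cinner (Z (\<pi> A \<Omega>)) (\<pi> A \<Omega>)"
      unfolding f_def rep_mult rep_adj[of "adj A"] by (simp add: adj_adj comm)
    then have "cmod (f (adj A * A)) \<le> norm (Z (\<pi> A \<Omega>)) * norm (\<pi> A \<Omega>)"
      using cinner_Cauchy_Schwarz by metis
    also have "\<dots> \<le> onorm Z * norm (\<pi> A \<Omega>) * norm (\<pi> A \<Omega>)"
      by (intro mult_right_mono Z_le norm_ge_zero)
    finally show ?thesis by (simp add: norm_rep_cyclic[symmetric] power2_eq_square mult.assoc)
  qed
  ultimately have f_phi: "f A = f 1 * \<phi> A" for A
    by (rule invariant_functional_eq_multiple)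
  define c where "c = f 1"
  have "cinner (Z \<Omega> - c *\<^sub>C \<Omega>) (\<pi> A \<Omega>) = 0" for A
  proof -
    have "cinner (Z \<Omega> - c *\<^sub>C \<Omega>) (\<pi> A \<Omega>) = f (adj A) - c * cinner (\<pi> (adj A) \<Omega>) \<Omega>"
      by (simp add: f_def cinner_diff_left cinner_scaleC_left rep_adj adj_adj)
    then show ?thesis using f_phi[of "adj A"] by (simp add: vector_state c_def)
  qed
  then have "Z \<Omega> = c *\<^sub>C \<Omega>" using eq_zero_of_orthogonal[of "Z \<Omega> - c *\<^sub>C \<Omega>"] by simp
  then have "Z (\<pi> A \<Omega>) = c *\<^sub>C \<pi> A \<Omega>" for A by (simp add: comm rep_vec_scaleC)
  then have "Z = (\<lambda>x. c *\<^sub>C x)" by (rule bounded_ops_eqI[OF Zb scaleC_in_bounded_ops])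
  then show "Z \<in> range (\<lambda>c x. c *\<^sub>C x)" by blast
next
  fix Z assume "Z \<in> range (\<lambda>c (x :: 'h). c *\<^sub>C x)"
  then obtain c where Z: "Z = (\<lambda>x. c *\<^sub>C x)" by blast
  have "Z \<in> gns_center \<pi>"
    unfolding gns_center_def gns_vn_algebra_def Z
    by (intro IntI scaleC_in_commutant commutant_subset_bounded_ops) (auto simp: rep_bounded_op)
  then show "Z \<in> invariant_center \<pi> U"
    unfolding invariant_center_def Z
    by (simp add: fun_eq_iff unitary_scaleC unitary_inv_right)
qed

text \<open>An expectation onto the scalars has values \<open>c 1\<close>, and preservation of the
  vector state with \<Omega> of norm one determines c. Existence and uniqueness of this map evaluate
  the definite description.\<close>

lemma gns_expectation_eq:
  assumes X: "X \<in> gns_vn_algebra \<pi>"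
  shows "gns_expectation \<pi> \<Omega> U X = (\<lambda>x. cinner (X \<Omega>) \<Omega> *\<^sub>C x)"
proof -
  let ?M = "gns_vn_algebra \<pi>"
  \<comment> \<open>The value \<open>undefined\<close> off the algebra matches the extensional
    function space in \<open>conditional_expectation\<close>, so uniqueness holds as equality of
    functions.\<close>
  define E0 where "E0 X = (if X \<in> ?M then (\<lambda>x :: 'h. cinner (X \<Omega>) \<Omega> *\<^sub>C x) else undefined)" for X
  have closed: "(\<lambda>x. X x + Y x) \<in> ?M" "(\<lambda>x. c *\<^sub>C X x) \<in> ?M" "X \<circ> Y \<in> ?M"
    if "X \<in> ?M" "Y \<in> ?M" for X Y c
    using that unfolding gns_vn_algebra_def
    by (simp_all only: commutant_add[OF commutant_subset_bounded_ops]
        commutant_scaleC[OF commutant_subset_bounded_ops] commutant_comp)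
  have scalar: "(\<lambda>x. c *\<^sub>C x) \<in> ?M" for c
    unfolding gns_vn_algebra_def by (intro scaleC_in_commutant commutant_subset_bounded_ops)
  have linear: "X (c *\<^sub>C x) = c *\<^sub>C X x" if "X \<in> ?M" for X c x
    using that commutant_subset_bounded_ops unfolding gns_vn_algebra_def bounded_ops_def by blast
  have E0: "conditional_expectation ?M (invariant_center \<pi> U) E0"
    unfolding conditional_expectation_def invariant_center_eq_scalars
  proof (intro conjI ballI allI impI)
    show "E0 \<in> ?M \<rightarrow>\<^sub>E range (\<lambda>c x. c *\<^sub>C x)" by (auto simp: E0_def)
    fix X assume X: "X \<in> ?M"
    show "E0 (\<lambda>x. X x + Y x) = (\<lambda>x. E0 X x + E0 Y x)" if "Y \<in> ?M" for Y
      using X that by (simp add: E0_def closed cinner_add_left scaleC_add_left fun_eq_iff)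
    show "E0 (\<lambda>x. c *\<^sub>C X x) = (\<lambda>x. c *\<^sub>C E0 X x)" for c
      using X closed(2)[OF X X] by (simp add: E0_def cinner_scaleC_left scaleC_scaleC fun_eq_iff)
    show "positive_op (E0 X)" if "positive_op X"
    proof -
      have "cinner (X \<Omega>) \<Omega> \<in> \<real>\<^sub>\<ge>\<^sub>0" using that unfolding positive_op_def by blast
      then show ?thesis
        using X scaleC_in_bounded_ops
        by (simp add: positive_op_def E0_def cinner_scaleC_left cinner_self nonneg_Reals_mult_I
            del: of_real_power)
    qed
    fix Z W assume "Z \<in> range (\<lambda>c (x :: 'h). c *\<^sub>C x)" "W \<in> range (\<lambda>c (x :: 'h). c *\<^sub>C x)"
    then obtain z w where "Z = (\<lambda>x. z *\<^sub>C x)" "W = (\<lambda>x. w *\<^sub>C x)" by blast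
    moreover have "Z \<circ> X \<circ> W \<in> ?M"
      unfolding calculation using X by (intro closed scalar)
    ultimately show "E0 (Z \<circ> X \<circ> W) = Z \<circ> E0 X \<circ> W"
      using X by (simp add: E0_def fun_eq_iff linear cinner_scaleC_left scaleC_scaleC mult_ac)
  next
    fix Z assume "Z \<in> range (\<lambda>c (x :: 'h). c *\<^sub>C x)"
    then show "E0 Z = Z"
      using scalar by (auto simp: E0_def cinner_scaleC_left cinner_cyclic)
  qed
  have E0_state: "\<forall>X\<in>?M. cinner (E0 X \<Omega>) \<Omega> = cinner (X \<Omega>) \<Omega>"
    by (simp add: E0_def cinner_scaleC_left cinner_cyclic)
  have "E = E0" if E: "conditional_expectation ?M (invariant_center \<pi> U) E"
    and E_state: "\<forall>X\<in>?M. cinner (E X \<Omega>) \<Omega> = cinner (X \<Omega>) \<Omega>" for E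
  proof
    fix X
    have E_fun: "E \<in> ?M \<rightarrow>\<^sub>E range (\<lambda>c x. c *\<^sub>C x)"
      using E unfolding conditional_expectation_def invariant_center_eq_scalars by blast
    show "E X = E0 X"
    proof (cases "X \<in> ?M")
      case True
      then obtain c where c: "E X = (\<lambda>x. c *\<^sub>C x)" using E_fun by blast
      then have "c = cinner (X \<Omega>) \<Omega>"
        using E_state True by (metis cinner_scaleC_left cinner_cyclic mult.right_neutral)
      then show ?thesis using c True by (simp add: E0_def)
    next
      case False
      then show ?thesis using PiE_arb[OF E_fun] by (simp add: E0_def)
    qed
  qed
  then have "gns_expectation \<pi> \<Omega> U = E0"
    unfolding gns_expectation_def using E0 E0_state by (intro the_equality) blast+
  then show ?thesis using X by (simp add: E0_def)
qed

lemma shift_limit_weak_operator_topology: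
  "limitin weak_operator_topology (\<lambda>n. U (block_swap n) \<circ> \<pi> A \<circ> inv (U (block_swap n)))
     (\<lambda>x. \<phi> A *\<^sub>C x) sequentially"
proof (rule limitin_weak_operator_topologyI[OF scaleC_in_bounded_ops])
  \<comment> \<open>Only positive indices give finite permutations; both goals below are transported
    along the successor, which does not affect limits.\<close>
  have eq: "U (block_swap (Suc n)) \<circ> \<pi> A \<circ> inv (U (block_swap (Suc n))) = \<pi> (shift n A)" for n
    unfolding shift_def using unitary_implements[OF block_swap_in_finite_perms] by metis
  show "\<forall>\<^sub>F n in sequentially. U (block_swap n) \<circ> \<pi> A \<circ> inv (U (block_swap n)) \<in> bounded_ops"
    by (subst eventually_sequentially_Suc[symmetric]) (simp only: eq rep_bounded_op eventually_True)
  show "(\<lambda>n. cinner ((U (block_swap n) \<circ> \<pi> A \<circ> inv (U (block_swap n))) x) y)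
      \<longlonglongrightarrow> cinner (\<phi> A *\<^sub>C x) y" for x y
    by (subst filterlim_sequentially_Suc[symmetric])
      (simp only: eq cinner_scaleC_left matrix_coefficient_limit)
qed

end

theorem proposition5p4:
  fixes a :: "nat \<Rightarrow> 'a::cstar_algebra"
    and \<phi> :: "'a \<Rightarrow>\<^sub>L complex"
    and \<pi> :: "'a \<Rightarrow> 'h::complex_hilbert_space \<Rightarrow> 'h"
    and \<Omega> :: 'h
    and U :: "(nat \<Rightarrow> nat) \<Rightarrow> 'h \<Rightarrow> 'h"
    and A :: 'a
  assumes "car_algebra a"
    and "\<phi> extreme_point_of (symmetric_states a)"
    and "gns_triple \<phi> \<pi> \<Omega>"
    and "gns_implementation a \<pi> \<Omega> U"
  shows "limitin weak_operator_topology
           (\<lambda>n. U (block_swap n) \<circ> \<pi> A \<circ> inv (U (block_swap n))) (\<lambda>x. \<phi> A *\<^sub>C x) sequentially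
         \<and> (\<lambda>x. \<phi> A *\<^sub>C x) = gns_expectation \<pi> \<Omega> U (\<pi> A)"
proof -
  interpret gns_extreme_state a \<phi> \<pi> \<Omega> U
    using assms by unfold_locales
  show ?thesis
    using shift_limit_weak_operator_topology gns_expectation_eq[OF rep_in_vn_algebra]
    by (simp add: vector_state)
qed

end
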